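(* Let $q$ be a prime power, let $n$ and $d\geq 0$ be integers with $n = d+1$ or $n > 2d$, and let $G$ be the $n$-dimensional $q$-Hamming graph, with vertex set $\mathcal{V}$ (the set of all subspaces of $\mathbb{F}_q^n$). Let $\mathcal{F}\subseteq \mathcal{V}$. If $\mathrm{diam}(\mathcal{F}) \leq d$, then $$|\mathcal{F}| \leq \sum_{i=0}^{t}\binom{n}{i}_q \quad\text{if } d = 2t,$$ and $$|\mathcal{F}| \leq \sum_{i=0}^{t}\binom{n}{i}_q + \binom{n-1}{t}_q \quad\text{if } d = 2t+1,$$ where $t = \lfloor d/2\rfloor$.
   Context: Let $\mathcal{V}$ be the set of all linear subspaces of $\mathbb{F}_q^n$. The $n$-dimensional $q$-Hamming graph is the (simple, undirected) graph with vertex set $\mathcal{V}$ in which two subspaces $A,B$ are joined by an edge if and only if, up to exchanging $A$ and $B$, $A\subseteq B$ and $\dim B-\dim A = 1$. Let $\delta_G(A,B)$ be the graph distance, i.e. the length of a shortest path in $G$ between $A$ and $B$. For $\mathcal{F}\subseteq\mathcal{V}$, $\mathrm{diam}(\mathcal{F}) = \max_{A,B\in\mathcal{F}}\delta_G(A,B)$ (so $\mathrm{diam}(\mathcal{F})\leq d$ means $\delta_G(A,B)\leq d$ for all $A,B\in\mathcal{F}$). The Gaussian binomial coefficient $\binom{n}{k}_q = \frac{(q^n-1)\cdots(q^{n-k+1}-1)}{(q^k-1)\cdots(q-1)}$ is the number of $k$-dimensional subspaces of $\mathbb{F}_q^n$ (with $\binom{n}{0}_q=1$). *)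

theory Defs
  imports "HOL-Analysis.Analysis" "Graph_Theory.Graph_Theory"
begin

text \<open>
  The field with \<open>q\<close> elements is a type \<open>'a\<close> of classes \<open>field\<close> and \<open>finite\<close> with
  \<open>CARD('a) = q\<close> (so \<open>q\<close> is automatically a prime power), and its \<open>n\<close>-dimensional coordinate
  space is \<open>'a ^ 'n\<close> with \<open>CARD('n) = n\<close>.  As usual for \<^typ>\<open>'a pair_pre_digraph\<close>, an undirected
  edge is represented by the two opposite arcs.
\<close>

definition q_hamming_graph :: "('a::{field,finite} ^ 'n) set pair_pre_digraph" where
  "q_hamming_graph =
     \<lparr> pverts = {A. vec.subspace A},
       parcs = {(A, B). vec.subspace A \<and> vec.subspace B \<and>
                  (A \<subseteq> B \<and> vec.dim B = vec.dim A + 1 \<or> B \<subseteq> A \<and> vec.dim A = vec.dim B + 1)} \<rparr>"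

lemma pair_graph_q_hamming_graph:
  "pair_graph (q_hamming_graph :: ('a::{field,finite} ^ 'n) set pair_pre_digraph)"
  by unfold_locales (auto simp: q_hamming_graph_def sym_def symmetric_def)

text \<open>
  With unit weights the cost of a walk is its length.  Values are extended reals, so vertices in
  different components are at distance \<open>\<infinity>\<close>.
\<close>

definition graph_dist :: "'v pair_pre_digraph \<Rightarrow> 'v \<Rightarrow> 'v \<Rightarrow> ereal" where
  "graph_dist G u v = wf_digraph.\<mu> (with_proj G) (\<lambda>_. 1) u v"

text \<open>The distances are taken in the whole graph \<open>G\<close>, not in the subgraph induced by \<open>F\<close>.\<close>

definition graph_diam :: "'v pair_pre_digraph \<Rightarrow> 'v set \<Rightarrow> ereal" where
  "graph_diam G F = (SUP (u, v) \<in> F \<times> F. graph_dist G u v)"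

lemma graph_diam_le_iff:
  "graph_diam G F \<le> c \<longleftrightarrow> (\<forall>u\<in>F. \<forall>v\<in>F. graph_dist G u v \<le> c)"
  by (auto simp: graph_diam_def SUP_le_iff)

text \<open>Intended for \<open>k \<le> n\<close> and \<open>q \<ge> 2\<close>; for \<open>k > n\<close> the numerator contains the factor
  \<open>q ^ 0 - 1 = 0\<close>.\<close>

definition gaussian_binomial :: "nat \<Rightarrow> nat \<Rightarrow> nat \<Rightarrow> real" where
  "gaussian_binomial q n k =
     (\<Prod>i<k. (real q ^ (n - i) - 1)) / (\<Prod>i<k. (real q ^ (k - i) - 1))"

end

theory Submission
  imports Defs "HOL-Algebra.Algebraic_Closure_Type"
begin

text \<open>
  Two subspaces \<open>A\<close>, \<open>B\<close> at distance at most \<open>d\<close> satisfy \<open>dim A + dim B - 2 dim (A \<inter> B) \<le> d\<close>,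
  and everything below is derived from this inequality. A family is cut into its levels, the
  sets of its members of a fixed dimension, and the levels are bounded separately or in pairs.
  Write \<open>[n, k]\<close> for the Gaussian binomial coefficient and \<open>t = d div 2\<close>. Taking orthogonal
  complements preserves the inequality and exchanges the levels \<open>k\<close> and \<open>n - k\<close>.

  The main tool is an averaging argument (\<open>sum_level_le_1\<close>). Let \<open>C\<close> be a code, that is, a set
  of subspaces that violate the inequality pairwise. Every image of \<open>C\<close> under an invertible
  linear map contains at most one member of the family, and the general linear group is
  transitive on each level; averaging over the group gives
  \<open>(\<Sum>X\<in>C. |F_(dim X)| / [n, dim X]) \<le> 1\<close>. Three codes are used: a pair of complementary
  subspaces; for \<open>k \<le> n - k\<close> the graphs of the linearized polynomials of bounded \<open>q\<close>-degree over
  the field with \<open>q ^ (n - k)\<close> elements, which form a maximum rank distance code; and, when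
  \<open>n = 2 * k\<close>, the spread of \<open>k\<close>-dimensional subspaces that arises from the graphs of degree
  zero by adding one further subspace.

  If \<open>n = d + 1\<close>, the complementary pairs bound the levels \<open>k\<close> and \<open>n - k\<close> together by \<open>[n, k]\<close>;
  for odd \<open>d\<close> there remains the middle level, whose bound \<open>[n - 1, t]\<close> comes from the spread.

  If \<open>n > 2 * d\<close>, there are two kinds of families. In the first kind, all dimensions are at most
  \<open>d - t\<close>, or dually at least \<open>n - (d - t)\<close>. Such a family has the levels \<open>0, \<dots>, t\<close> and, for odd
  \<open>d\<close>, a level \<open>t + 1\<close> of pairwise intersecting subspaces, which has at most \<open>[n - 1, t]\<close>
  members by an Erdos-Ko-Rado argument (\<open>card_level_intersecting\<close>). Families with \<open>d \<le> 1\<close> have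
  at most one member of each dimension, and for \<open>d \<ge> 2\<close> all families of the second kind stay
  below the bound as well. Such a family cannot contain both a member of dimension at most \<open>t\<close>
  and one of dimension at least \<open>n - t\<close>, so up to duality all dimensions are below \<open>n - t\<close>,
  while some member \<open>U\<close> has dimension above \<open>d - t\<close>. The members of dimension \<open>t\<close> must all meet
  \<open>U\<close>, which makes them few, and the levels strictly between \<open>t\<close> and \<open>n - t\<close> decay geometrically
  from both ends by the rank distance codes, so that together they have fewer than \<open>[n, t]\<close>
  members once \<open>t \<ge> 2\<close>. For \<open>t = 1\<close> that decay is too slow when \<open>q\<close> is small; there two members
  of a level meet in a hyperplane of each, so the members of a level either share a hyperplane
  or are hyperplanes of one subspace, and this bounds the level by \<open>[m, 1]\<close>, where \<open>m\<close> is the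
  larger of \<open>k + 1\<close> and \<open>n - k + 1\<close> for the dimension \<open>k\<close> of the level. Together with the
  inclusions between members of neighbouring levels when \<open>d = 2\<close>, these bounds suffice.
\<close>

(* The dollar sign is reserved for vector components, and X is a variable. *)
no_notation fps_nth (infixl \<open>$\<close> 75)
no_notation var (\<open>X\<index>\<close>)

section \<open>Graph distance and dimensions\<close>

text \<open>
  The condition \<open>dim A + dim B - 2 dim (A \<inter> B) \<le> d\<close>, written without subtraction. The left-hand
  side is the subspace distance, which never exceeds the graph distance.
\<close>

definition diam_le :: "nat \<Rightarrow> ('a::{field,finite} ^ 'n) set set \<Rightarrow> bool" where
  "diam_le d F \<longleftrightarrow> (\<forall>A\<in>F. vec.subspace A) \<and>
     (\<forall>A\<in>F. \<forall>B\<in>F. vec.dim A + vec.dim B \<le> d + 2 * vec.dim (A \<inter> B))"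

lemma dim_sum_span:
  fixes A B :: "('a::{field,finite} ^ 'n) set"
  assumes "vec.subspace A" "vec.subspace B"
  shows "vec.dim (vec.span (A \<union> B)) + vec.dim (A \<inter> B) = vec.dim A + vec.dim B"
proof -
  have "vec.span (A \<union> B) = {x + y |x y. x \<in> A \<and> y \<in> B}"
    using assms by (simp add: vec.span_Un vec.span_eq_iff[THEN iffD2])
  then show ?thesis using vec.dim_sums_Int[OF assms] by simp
qed

lemma dim_Int_codim_le:
  fixes A B C :: "('a::{field,finite} ^ 'n) set"
  assumes "vec.subspace A" "vec.subspace B" "vec.subspace C" "C \<subseteq> B"
  shows "vec.dim (A \<inter> B) + vec.dim C \<le> vec.dim (A \<inter> C) + vec.dim B"
proof -
  have s: "vec.subspace (A \<inter> B)" by (simp add: assms vec.subspace_inter)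
  have "vec.dim (vec.span ((A \<inter> B) \<union> C)) \<le> vec.dim B"
    using assms by (intro vec.dim_subset vec.span_minimal) auto
  moreover have "(A \<inter> B) \<inter> C = A \<inter> C" using assms by auto
  ultimately show ?thesis using dim_sum_span[OF s assms(3)] by simp
qed

text \<open>
  An edge of the graph changes the subspace distance to a fixed \<open>B\<close> by at most one, because
  passing to a hyperplane lowers the dimension of the intersection with \<open>B\<close> by at most one.
\<close>

lemma walk_length_ge:
  fixes A B :: "('a::{field,finite} ^ 'n) set"
  assumes "pre_digraph.awalk (with_proj q_hamming_graph) A p B"
  shows "vec.dim A + vec.dim B \<le> length p + 2 * vec.dim (A \<inter> B)"
proof -
  interpret pair_graph "q_hamming_graph :: ('a ^ 'n) set pair_pre_digraph"
    by (rule pair_graph_q_hamming_graph)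
  show ?thesis using assms
  proof (induction p arbitrary: A)
    case Nil
    then show ?case by (auto simp: awalk_Nil_iff)
  next
    case (Cons e p)
    obtain C where e: "(A, C) \<in> parcs q_hamming_graph" "awalk C p B"
      using Cons.prems by (cases e) (auto simp: awalk_Cons_iff)
    have sB: "vec.subspace B" using awalk_last_in_verts[OF e(2)] e(2)
      by (auto simp: q_hamming_graph_def awalk_def dest!: awlast_in_verts)
    have IH: "vec.dim C + vec.dim B \<le> length p + 2 * vec.dim (C \<inter> B)"
      using Cons.IH[OF e(2)] .
    have s: "vec.subspace A" "vec.subspace C" using e(1) by (auto simp: q_hamming_graph_def)
    consider "A \<subseteq> C" "vec.dim C = vec.dim A + 1" | "C \<subseteq> A" "vec.dim A = vec.dim C + 1"
      using e(1) by (auto simp: q_hamming_graph_def)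
    then show ?case
    proof cases
      case 1
      have "vec.dim (B \<inter> C) + vec.dim A \<le> vec.dim (B \<inter> A) + vec.dim C"
        by (rule dim_Int_codim_le) (use s sB 1 in auto)
      then show ?thesis using IH 1 by (simp add: Int_commute)
    next
      case 2
      then have "vec.dim (C \<inter> B) \<le> vec.dim (A \<inter> B)" by (intro vec.dim_subset) auto
      then show ?thesis using IH 2 by simp
    qed
  qed
qed

lemma diam_le_of_graph_diam:
  fixes F :: "('a::{field,finite} ^ 'n) set set"
  assumes "F \<subseteq> pverts q_hamming_graph" "graph_diam q_hamming_graph F \<le> ereal (real d)"
  shows "diam_le d F"
proof -
  interpret pair_graph "q_hamming_graph :: ('a ^ 'n) set pair_pre_digraph"
    by (rule pair_graph_q_hamming_graph)
  have "vec.dim A + vec.dim B \<le> d + 2 * vec.dim (A \<inter> B)" if "A \<in> F" "B \<in> F" for A B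
  proof -
    have "ereal (real (vec.dim A + vec.dim B) - real (2 * vec.dim (A \<inter> B))) \<le> graph_dist q_hamming_graph A B"
      unfolding graph_dist_def \<mu>_def
    proof (rule INF_greatest)
      fix p assume "p \<in> {p. awalk A p B}"
      then have "vec.dim A + vec.dim B \<le> length p + 2 * vec.dim (A \<inter> B)"
        using walk_length_ge by auto
      then show "ereal (real (vec.dim A + vec.dim B) - real (2 * vec.dim (A \<inter> B))) \<le> ereal (awalk_cost (\<lambda>_. 1) p)"
        by (simp add: awalk_cost_def sum_list_triv)
    qed
    also have "\<dots> \<le> ereal (real d)"
      using assms(2) that by (auto simp: graph_diam_le_iff)
    finally show ?thesis by simp
  qed
  then show ?thesis using assms(1) by (auto simp: diam_le_def q_hamming_graph_def)
qed

section \<open>Counting subspaces\<close>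

lemma card_field_ge2: "CARD('a::{field,finite}) \<ge> 2"
proof -
  have "card {0, 1 :: 'a} \<le> CARD('a)" by (intro card_mono) auto
  then show ?thesis by simp
qed

text \<open>
  Stated for an arbitrary vector space over the finite field, since it is applied both to the
  coordinate space and to the algebraic closure of the field.
\<close>

lemma card_span_independent:
  fixes scale :: "'a::{field,finite} \<Rightarrow> 'b::ab_group_add \<Rightarrow> 'b"
  assumes "vector_space scale" "finite B" "\<not> module.dependent scale B"
  shows "finite (module.span scale B) \<and> card (module.span scale B) = CARD('a) ^ card B"
proof -
  interpret vector_space scale by fact
  show ?thesis using assms(2,3)
  proof (induction B)
    case empty
    then show ?case by simp
  next
    case (insert b B)
    have ind: "independent B" "b \<notin> span B"
      using insert.prems insert.hyps independent_insert[of b B] by auto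
    define f where "f = (\<lambda>(c, x). scale c b + x)"
    have inj: "inj_on f (UNIV \<times> span B)"
    proof (rule inj_onI, clarify)
      fix c x c' x'
      assume xs: "x \<in> span B" "x' \<in> span B" and "f (c, x) = f (c', x')"
      then have eq: "scale (c - c') b = x' - x"
        by (simp add: f_def scale_left_diff_distrib algebra_simps)
      have "c = c'"
      proof (rule ccontr)
        assume "c \<noteq> c'"
        then have "b = scale (inverse (c - c')) (x' - x)"
          by (simp flip: eq)
        then show False using ind(2) xs span_scale span_diff by metis
      qed
      then show "c = c' \<and> x = x'" using eq by simp
    qed
    have "span (insert b B) = f ` (UNIV \<times> span B)"
    proof (intro subset_antisym subsetI)
      fix x assume "x \<in> span (insert b B)"
      then obtain k where "x - scale k b \<in> span B" by (auto simp: span_insert)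
      then show "x \<in> f ` (UNIV \<times> span B)"
        by (intro image_eqI[of _ _ "(k, x - scale k b)"]) (auto simp: f_def)
    next
      fix x assume "x \<in> f ` (UNIV \<times> span B)"
      then obtain c y where "y \<in> span B" "x = scale c b + y" by (auto simp: f_def)
      then show "x \<in> span (insert b B)" by (auto simp: span_insert intro!: exI[of _ c])
    qed
    then show ?case
      using insert.IH[OF ind(1)] insert.hyps card_image[OF inj] by (simp add: card_cartesian_product)
  qed
qed

lemma card_subspace:
  fixes S :: "('a::{field,finite} ^ 'n) set"
  assumes "vec.subspace S"
  shows "card S = CARD('a) ^ vec.dim S"
proof -
  obtain B where B: "finite B" "vec.independent B" "vec.span B = S" "card B = vec.dim S"
    using vec.basis_subspace_exists[OF assms] by metis
  show ?thesis
    using card_span_independent[OF vec.vector_space_axioms B(1,2)] B by simp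
qed

lemma vec_dim_UNIV: "vec.dim (UNIV :: ('a::field ^ 'n) set) = CARD('n)"
  by (simp add: vec.dim_UNIV card_cart_basis)

lemma dim_le_iff_card_le:
  fixes S T :: "('a::{field,finite} ^ 'n) set"
  assumes "vec.subspace S"
  shows "vec.dim S \<le> k \<longleftrightarrow> card S \<le> CARD('a) ^ k"
  using card_subspace[OF assms] card_field_ge2[where 'a='a] by simp

definition subspaces_between :: "('a::{field,finite} ^ 'n) set \<Rightarrow> ('a ^ 'n) set \<Rightarrow> nat \<Rightarrow> ('a ^ 'n) set set" where
  "subspaces_between X U k = {A. vec.subspace A \<and> X \<subseteq> A \<and> A \<subseteq> U \<and> vec.dim A = k}"

text \<open>
  Each vector of \<open>U - X\<close> lies in exactly one of the subspaces counted here, the span of \<open>X\<close> and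
  the vector, and each of these subspaces contains \<open>q ^ (dim X + 1) - q ^ dim X\<close> such vectors.
\<close>

lemma card_subspaces_between_Suc_dim:
  fixes X U :: "('a::{field,finite} ^ 'n) set"
  assumes "vec.subspace X" "vec.subspace U" "X \<subseteq> U"
  shows "real (card (subspaces_between X U (Suc (vec.dim X)))) =
    (real CARD('a) ^ (vec.dim U - vec.dim X) - 1) / (real CARD('a) - 1)"
proof -
  let ?q = "CARD('a)" and ?x = "vec.dim X" and ?B = "subspaces_between X U (Suc (vec.dim X))"
  have sp: "vec.span (insert v X) = A" if "A \<in> ?B" "v \<in> A - X" for A v
  proof (rule vec.subspace_dim_equal)
    show "vec.subspace (vec.span (insert v X))" "vec.subspace A"
      using that by (auto simp: subspaces_between_def)
    show "vec.span (insert v X) \<subseteq> A"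
      using that by (intro vec.span_minimal) (auto simp: subspaces_between_def)
    have "v \<notin> vec.span X" using that assms by (simp add: vec.span_eq_iff[THEN iffD2])
    then show "vec.dim A \<le> vec.dim (vec.span (insert v X))"
      using that by (auto simp: vec.dim_insert subspaces_between_def)
  qed
  have "U - X = (\<Union>A\<in>?B. A - X)"
  proof (intro subset_antisym subsetI)
    fix v assume v: "v \<in> U - X"
    then have "v \<notin> vec.span X" using assms by (simp add: vec.span_eq_iff[THEN iffD2])
    then have "vec.span (insert v X) \<in> ?B"
      using v assms vec.span_minimal[of "insert v X" U] vec.span_superset[of "insert v X"]
      by (simp add: subspaces_between_def vec.dim_insert)
    then show "v \<in> (\<Union>A\<in>?B. A - X)" using v by (auto intro!: bexI[of _ "vec.span (insert v X)"] vec.span_base)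
  qed (auto simp: subspaces_between_def)
  then have "card (U - X) = (\<Sum>A\<in>?B. card (A - X))"
  proof (subst card_UN_disjoint[symmetric])
    show "\<forall>A\<in>?B. \<forall>A'\<in>?B. A \<noteq> A' \<longrightarrow> (A - X) \<inter> (A' - X) = {}"
      using sp by (metis Int_iff all_not_in_conv)
  qed auto
  also have "\<dots> = (\<Sum>A\<in>?B. ?q ^ Suc ?x - ?q ^ ?x)"
  proof (rule sum.cong[OF refl])
    fix A assume "A \<in> ?B"
    then show "card (A - X) = ?q ^ Suc ?x - ?q ^ ?x"
      using assms card_subspace[of A] card_subspace[of X]
      by (subst card_Diff_subset) (auto simp: subspaces_between_def)
  qed
  finally have eq: "card (U - X) = card ?B * (?q ^ Suc ?x - ?q ^ ?x)" by simp
  have le: "?x \<le> vec.dim U" using assms vec.dim_subset by auto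
  have "card (U - X) = ?q ^ vec.dim U - ?q ^ ?x"
    using assms card_subspace[of U] card_subspace[of X] by (subst card_Diff_subset) auto
  then have "real (card ?B) * (real ?q ^ Suc ?x - real ?q ^ ?x) = real ?q ^ vec.dim U - real ?q ^ ?x"
  proof -
    have "?q ^ ?x \<le> ?q ^ Suc ?x" "?q ^ ?x \<le> ?q ^ vec.dim U"
      using le card_field_ge2[where 'a='a] by (auto intro!: power_increasing)
    then show ?thesis
      using eq \<open>card (U - X) = ?q ^ vec.dim U - ?q ^ ?x\<close>
      by (simp only: of_nat_diff flip: of_nat_power of_nat_mult) (metis of_nat_diff of_nat_mult)
  qed
  moreover have "real ?q ^ vec.dim U = real ?q ^ ?x * real ?q ^ (vec.dim U - ?x)"
    using le by (simp flip: power_add)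
  ultimately have "real ?q ^ ?x * (real (card ?B) * (real ?q - 1)) =
      real ?q ^ ?x * (real ?q ^ (vec.dim U - ?x) - 1)"
    by (simp add: algebra_simps)
  then have "real (card ?B) * (real ?q - 1) = real ?q ^ (vec.dim U - ?x) - 1"
    by simp
  moreover have "real ?q - 1 > 0" using card_field_ge2[where 'a='a] by simp
  ultimately show ?thesis by (simp add: field_simps)
qed

lemma gaussian_binomial_0 [simp]: "gaussian_binomial q n 0 = 1"
  by (simp add: gaussian_binomial_def)

lemma gaussian_binomial_0_Suc [simp]: "gaussian_binomial q 0 (Suc k) = 0"
  by (simp add: gaussian_binomial_def lessThan_Suc_eq_insert_0)

lemma gaussian_binomial_Suc_Suc:
  "gaussian_binomial q (Suc n) (Suc k) =
     (real q ^ Suc n - 1) / (real q ^ Suc k - 1) * gaussian_binomial q n k"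
  unfolding gaussian_binomial_def prod.lessThan_Suc_shift by simp

lemma frac_cancel:
  fixes a b c g N :: real
  assumes "c > 0" "a > 0" "N * (a / c) = b / c * g"
  shows "N = b / a * g"
  using assms by (simp add: field_simps)

lemma sum_card_swap:
  assumes "finite A" "finite B"
  shows "(\<Sum>x\<in>A. card {y \<in> B. R x y}) = (\<Sum>y\<in>B. card {x \<in> A. R x y})"
  using sum.swap_restrict[OF assms, of "\<lambda>_ _. 1::nat" R] by simp

text \<open>
  Induction on \<open>j\<close>: the pairs \<open>Y \<subseteq> A\<close> with \<open>dim Y = dim X + 1\<close> and \<open>dim A = dim X + Suc j\<close> are
  counted once by \<open>Y\<close>, where the induction hypothesis applies above \<open>Y\<close>, and once by \<open>A\<close>. The
  resulting recursion is the one of \<open>gaussian_binomial_Suc_Suc\<close>.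
\<close>

lemma card_subspaces_between:
  fixes X U :: "('a::{field,finite} ^ 'n) set"
  assumes "vec.subspace X" "vec.subspace U" "X \<subseteq> U"
  shows "real (card (subspaces_between X U (vec.dim X + j))) = gaussian_binomial CARD('a) (vec.dim U - vec.dim X) j"
  using assms(1,3)
proof (induction j arbitrary: X)
  case 0
  have "A = X" if "A \<in> subspaces_between X U (vec.dim X)" for A
    using that 0 vec.subspace_dim_equal[of X A] by (auto simp: subspaces_between_def)
  then have "subspaces_between X U (vec.dim X) = {X}" using 0 by (auto simp: subspaces_between_def)
  then show ?case by simp
next
  case (Suc j)
  let ?q = "CARD('a)" and ?x = "vec.dim X"
  have q: "real ?q > 1" using card_field_ge2[where 'a='a] by simp
  have le: "?x \<le> vec.dim U" using Suc vec.dim_subset by auto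
  show ?case
  proof (cases "vec.dim U - ?x")
    case 0
    have "A \<notin> subspaces_between X U (?x + Suc j)" for A
      using vec.dim_subset[of A U] 0 by (auto simp: subspaces_between_def)
    then have "subspaces_between X U (?x + Suc j) = {}" by blast
    then show ?thesis using 0 by simp
  next
    case (Suc m)
    let ?Y = "subspaces_between X U (Suc ?x)" and ?A = "subspaces_between X U (?x + Suc j)"
    have Y: "real (card {A \<in> ?A. Y \<subseteq> A}) = gaussian_binomial ?q m j" if "Y \<in> ?Y" for Y
    proof -
      have "{A \<in> ?A. Y \<subseteq> A} = subspaces_between Y U (vec.dim Y + j)"
        using that by (auto simp: subspaces_between_def)
      moreover have "vec.dim U - vec.dim Y = m" using that Suc by (auto simp: subspaces_between_def)
      ultimately show ?thesis using Suc.IH[of Y] that by (auto simp: subspaces_between_def)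
    qed
    have A: "real (card {Y \<in> ?Y. Y \<subseteq> A}) = (real ?q ^ Suc j - 1) / (real ?q - 1)" if "A \<in> ?A" for A
    proof -
      have "{Y \<in> ?Y. Y \<subseteq> A} = subspaces_between X A (Suc ?x)"
        using that by (auto simp: subspaces_between_def)
      moreover have "vec.dim A - ?x = Suc j" using that by (auto simp: subspaces_between_def)
      ultimately show ?thesis using card_subspaces_between_Suc_dim[of X A] that Suc.prems by (auto simp: subspaces_between_def)
    qed
    have "real (card ?Y) * gaussian_binomial ?q m j = (\<Sum>Y\<in>?Y. real (card {A \<in> ?A. Y \<subseteq> A}))"
      using Y by simp
    also have "\<dots> = (\<Sum>A\<in>?A. real (card {Y \<in> ?Y. Y \<subseteq> A}))"
      using sum_card_swap[of ?Y ?A "(\<subseteq>)"] by (simp flip: of_nat_sum)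
    also have "\<dots> = real (card ?A) * ((real ?q ^ Suc j - 1) / (real ?q - 1))"
      using A by simp
    finally have "real (card ?A) * ((real ?q ^ Suc j - 1) / (real ?q - 1)) =
      (real ?q ^ Suc m - 1) / (real ?q - 1) * gaussian_binomial ?q m j"
      using card_subspaces_between_Suc_dim[of X U] Suc.prems assms(2) Suc by (simp only:)
    moreover have "real ?q ^ Suc j > 1" using q by (intro one_less_power) auto
    ultimately have "real (card ?A) = (real ?q ^ Suc m - 1) / (real ?q ^ Suc j - 1) * gaussian_binomial ?q m j"
      using q by (intro frac_cancel[of "real ?q - 1" "real ?q ^ Suc j - 1"]) (simp del: power_Suc, simp del: power_Suc, assumption)
    then show ?thesis using Suc by (simp add: gaussian_binomial_Suc_Suc del: power_Suc)
  qed
qed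

definition level :: "('a::{field,finite} ^ 'n) set set \<Rightarrow> nat \<Rightarrow> ('a ^ 'n) set set" where
  "level F k = {A \<in> F. vec.dim A = k}"

lemma card_subspaces_dim:
  "real (card {A :: ('a::{field,finite} ^ 'n) set. vec.subspace A \<and> vec.dim A = k}) =
     gaussian_binomial CARD('a) CARD('n) k"
proof -
  have "subspaces_between {0} (UNIV :: ('a ^ 'n) set) (vec.dim {0 :: 'a ^ 'n} + k) = {A. vec.subspace A \<and> vec.dim A = k}"
    by (auto simp: subspaces_between_def vec.subspace_0)
  then show ?thesis using card_subspaces_between[of "{0 :: 'a ^ 'n}" UNIV k]
    by (simp add: vec_dim_UNIV del: vec.dim_UNIV)
qed

section \<open>Duality\<close>

definition perp :: "('a::{field,finite} ^ 'n) set \<Rightarrow> ('a ^ 'n) set" where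
  "perp A = {y. \<forall>x\<in>A. (\<Sum>i\<in>UNIV. x $ i * y $ i) = 0}"

lemma subspace_perp [simp]: "vec.subspace (perp A)"
  by (auto simp: vec.subspace_def perp_def algebra_simps sum.distrib simp flip: sum_distrib_left)

lemma perp_perp_superset: "A \<subseteq> perp (perp A)"
  by (auto simp: perp_def mult.commute)

lemma perp_antimono: "A \<subseteq> B \<Longrightarrow> perp B \<subseteq> perp A"
  by (auto simp: perp_def)

lemma perp_span [simp]: "perp (vec.span A) = perp A"
proof
  show "perp (vec.span A) \<subseteq> perp A" by (intro perp_antimono vec.span_superset)
  have "A \<subseteq> perp (perp A)" by (rule perp_perp_superset)
  then have "vec.span A \<subseteq> perp (perp A)" by (intro vec.span_minimal) auto
  then show "perp A \<subseteq> perp (vec.span A)"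
    using perp_antimono[of "vec.span A" "perp (perp A)"] perp_perp_superset[of "perp A"] by blast
qed

text \<open>
  \<open>perp (insert v X)\<close> is the kernel of the functional \<open>g\<close> on \<open>perp X\<close>, and each fibre of \<open>g\<close> is
  empty or a translate of the kernel; so \<open>perp X\<close> has at most \<open>q\<close> times as many elements.
\<close>

lemma dim_perp_insert_le: "vec.dim (perp X) \<le> vec.dim (perp (insert v X)) + 1"
  for X :: "('a::{field,finite} ^ 'n) set"
proof -
  define g where "g = (\<lambda>y :: 'a ^ 'n. \<Sum>i\<in>UNIV. v $ i * y $ i)"
  have fib: "card {y \<in> perp X. g y = c} \<le> card (perp (insert v X))" for c
  proof (cases "{y \<in> perp X. g y = c} = {}")
    case False
    then obtain z where z: "z \<in> perp X" "g z = c" by auto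
    have "(\<lambda>y. y - z) ` {y \<in> perp X. g y = c} \<subseteq> perp (insert v X)"
      using z vec.subspace_diff[OF subspace_perp] 
      by (auto simp: perp_def g_def algebra_simps sum_subtractf)
    then show ?thesis by (intro card_inj_on_le[of "\<lambda>y. y - z"]) auto
  next
    case True
    then show ?thesis by (simp only: card.empty)
  qed
  have "perp X = (\<Union>c. {y \<in> perp X. g y = c})" by auto
  then have "card (perp X) \<le> (\<Sum>c\<in>UNIV. card {y \<in> perp X. g y = c})"
    using card_UN_le[of "UNIV :: 'a set" "\<lambda>c. {y \<in> perp X. g y = c}"] by simp
  also have "\<dots> \<le> (\<Sum>c\<in>(UNIV::'a set). card (perp (insert v X)))" by (intro sum_mono fib)
  finally have "card (perp X) \<le> CARD('a) ^ (vec.dim (perp (insert v X)) + 1)"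
    using card_subspace[OF subspace_perp, of "insert v X"] by simp
  then show ?thesis by (simp add: dim_le_iff_card_le)
qed

text \<open>
  Adding the vectors of \<open>Y\<close> to \<open>X\<close> one at a time raises \<open>dim X\<close> by one and lowers \<open>dim (perp X)\<close>
  by at most one. The two extreme cases \<open>X = {0}\<close> and \<open>Y = UNIV\<close> are the two halves of the
  dimension formula \<open>dim_perp\<close>.
\<close>

lemma dim_perp_le:
  fixes X Y :: "('a::{field,finite} ^ 'n) set"
  assumes "vec.subspace X" "vec.subspace Y" "X \<subseteq> Y"
  shows "vec.dim (perp X) + vec.dim X \<le> vec.dim (perp Y) + vec.dim Y"
  using assms(1,3)
proof (induction "vec.dim Y - vec.dim X" arbitrary: X)
  case 0
  then have "X = Y" using assms(2) by (intro vec.subspace_dim_equal) auto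
  then show ?case by simp
next
  case (Suc k)
  then obtain v where v: "v \<in> Y" "v \<notin> X" by (metis diff_self_eq_0 nat.distinct(1) subsetI subset_antisym)
  let ?X = "vec.span (insert v X)"
  have "v \<notin> vec.span X" using v Suc.prems by (simp add: vec.span_eq_iff[THEN iffD2])
  then have d: "vec.dim ?X = vec.dim X + 1" by (simp add: vec.dim_insert)
  moreover have "?X \<subseteq> Y" using v Suc.prems assms by (intro vec.span_minimal) auto
  ultimately have "vec.dim (perp ?X) + vec.dim ?X \<le> vec.dim (perp Y) + vec.dim Y"
    using Suc.hyps(1)[of ?X] Suc.hyps(2) by simp
  then show ?case using d dim_perp_insert_le[of X v] by simp
qed

lemma perp_zero [simp]: "perp {0} = UNIV" by (auto simp: perp_def)

lemma perp_UNIV [simp]: "perp (UNIV :: ('a::{field,finite} ^ 'n) set) = {0}"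
proof -
  have "y = 0" if "y \<in> perp UNIV" for y :: "'a ^ 'n"
  proof (subst vec_eq_iff, intro allI)
    fix j
    have "(\<Sum>i\<in>UNIV. axis j 1 $ i * y $ i) = 0" using that by (auto simp: perp_def)
    then show "y $ j = 0 $ j" by (simp add: axis_def if_distrib[of "\<lambda>x. x * _"] cong: if_cong)
  qed
  then show ?thesis by (auto simp: perp_def)
qed

lemma dim_perp:
  fixes A :: "('a::{field,finite} ^ 'n) set"
  assumes "vec.subspace A"
  shows "vec.dim (perp A) + vec.dim A = CARD('n)"
  using dim_perp_le[of "{0}" A] dim_perp_le[of A UNIV] assms
  by (simp add: vec_dim_UNIV vec.subspace_0 del: vec.dim_UNIV)

lemma perp_perp [simp]:
  fixes A :: "('a::{field,finite} ^ 'n) set"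
  assumes "vec.subspace A"
  shows "perp (perp A) = A"
  using vec.subspace_dim_equal[of A "perp (perp A)"] assms perp_perp_superset[of A]
    dim_perp[of A] dim_perp[of "perp A"] by simp

lemma dim_perp_Int:
  fixes A B :: "('a::{field,finite} ^ 'n) set"
  assumes "vec.subspace A" "vec.subspace B"
  shows "vec.dim (perp A \<inter> perp B) + vec.dim A + vec.dim B = CARD('n) + vec.dim (A \<inter> B)"
proof -
  have "perp A \<inter> perp B = perp (vec.span (A \<union> B))"
    unfolding perp_span by (auto simp: perp_def)
  then show ?thesis using dim_perp[of "vec.span (A \<union> B)"] dim_sum_span[OF assms] by simp
qed

text \<open>
  Both sides of the inequality in \<open>diam_le\<close> change by the same amount, since
  \<open>dim (perp A \<inter> perp B) = n - dim (A + B)\<close>.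
\<close>

lemma diam_le_perp:
  assumes "diam_le d F"
  shows "diam_le d (perp ` F)"
  unfolding diam_le_def
proof (intro conjI ballI)
  fix A' B' assume "A' \<in> perp ` F" "B' \<in> perp ` F"
  then obtain A B where AB: "A \<in> F" "B \<in> F" "A' = perp A" "B' = perp B" by auto
  then have s: "vec.subspace A" "vec.subspace B" using assms by (auto simp: diam_le_def)
  have "vec.dim A + vec.dim B \<le> d + 2 * vec.dim (A \<inter> B)"
    using AB assms by (auto simp: diam_le_def)
  then show "vec.dim A' + vec.dim B' \<le> d + 2 * vec.dim (A' \<inter> B')"
    using dim_perp_Int[OF s] dim_perp[OF s(1)] dim_perp[OF s(2)] AB by simp
qed auto

lemma inj_on_perp: "inj_on perp {A. vec.subspace A}"
  by (metis (mono_tags) inj_onI mem_Collect_eq perp_perp)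

lemma card_level_perp:
  fixes F :: "('a::{field,finite} ^ 'n) set set"
  assumes "\<forall>A\<in>F. vec.subspace A" "k \<le> CARD('n)"
  shows "card (level (perp ` F) k) = card (level F (CARD('n) - k))"
proof -
  have "level (perp ` F) k = perp ` level F (CARD('n) - k)"
    using assms dim_perp by (fastforce simp: level_def)
  moreover have "inj_on perp (level F (CARD('n) - k))"
    by (rule inj_on_subset[OF inj_on_perp]) (use assms in \<open>auto simp: level_def\<close>)
  ultimately show ?thesis by (simp add: card_image)
qed

section \<open>Averaging over the general linear group\<close>

definition GL :: "(('a::{field,finite} ^ 'n) \<Rightarrow> ('a ^ 'n)) set" where
  "GL = {g. Vector_Spaces.linear (*s) (*s) g \<and> bij g}"

lemma GL_image:
  fixes g :: "('a::{field,finite} ^ 'n) \<Rightarrow> ('a ^ 'n)"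
  assumes "g \<in> GL"
  shows "vec.subspace A \<Longrightarrow> vec.subspace (g ` A)" "vec.dim (g ` A) = vec.dim A"
    "g ` (A \<inter> B) = g ` A \<inter> g ` B" "g ` A = g ` B \<longleftrightarrow> A = B"
proof -
  have lin: "Vector_Spaces.linear (*s) (*s) g" and inj: "inj g"
    using assms by (auto simp: GL_def bij_def)
  interpret g: Vector_Spaces.linear "(*s)" "(*s)" g by (rule lin)
  show "vec.subspace A \<Longrightarrow> vec.subspace (g ` A)" by (rule g.subspace_image)
  show "vec.dim (g ` A) = vec.dim A"
    by (rule vec.dim_image_eq[OF lin]) (use inj in \<open>auto intro: inj_on_subset\<close>)
  show "g ` (A \<inter> B) = g ` A \<inter> g ` B" using inj by (rule image_Int)
  show "g ` A = g ` B \<longleftrightarrow> A = B" using inj by (rule inj_image_eq_iff)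
qed

lemma GL_comp: "g \<in> GL \<Longrightarrow> h \<in> GL \<Longrightarrow> g \<circ> h \<in> GL"
  using Vector_Spaces.linear_compose[of "(*s)" "(*s)" h "(*s)" g] bij_comp[of h g] by (simp add: GL_def)

lemma GL_transitive:
  fixes A B :: "('a::{field,finite} ^ 'n) set"
  assumes "vec.subspace A" "vec.subspace B" "vec.dim A = vec.dim B"
  obtains g where "g \<in> GL" "g ` A = B"
proof -
  obtain S where S: "finite S" "vec.independent S" "vec.span S = A" "card S = vec.dim A"
    using vec.basis_subspace_exists[OF assms(1)] by metis
  obtain T where T: "finite T" "vec.independent T" "vec.span T = B" "card T = vec.dim B"
    using vec.basis_subspace_exists[OF assms(2)] by metis
  obtain f where f: "bij_betw f S T"
    using finite_same_card_bij[OF S(1) T(1)] S T assms by auto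
  obtain g where g: "Vector_Spaces.linear (*s) (*s) g" "inj g" "\<forall>x\<in>S. g x = f x"
    using vec.linear_independent_extend_inj[of S f] S T f by (auto simp: bij_betw_def)
  interpret g: Vector_Spaces.linear "(*s)" "(*s)" g by (rule g(1))
  have "g ` S = T" using g(3) f by (auto simp: bij_betw_def)
  then have "g ` A = B" using g.span_image[of S] S T by simp
  moreover have "g \<in> GL" using g vec.linear_inj_imp_surj[OF g(1,2)] by (auto simp: GL_def bij_def)
  ultimately show ?thesis using that by blast
qed

text \<open>
  The number of elements of \<open>GL\<close> that carry \<open>X\<close> to \<open>A\<close> is the same for all \<open>A\<close> of the dimension
  of \<open>X\<close>: composition with a map that carries \<open>B\<close> to \<open>A\<close> is injective, and the roles of \<open>A\<close> and
  \<open>B\<close> can be exchanged.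
\<close>

lemma card_GL_carrying:
  fixes X A :: "('a::{field,finite} ^ 'n) set"
  assumes "vec.subspace X" "vec.subspace A" "vec.dim X = vec.dim A"
  shows "real (card {g \<in> GL. g ` X = A}) * gaussian_binomial CARD('a) CARD('n) (vec.dim X) =
    real (card (GL :: (('a ^ 'n) \<Rightarrow> ('a ^ 'n)) set))"
proof -
  let ?Gr = "{B :: ('a ^ 'n) set. vec.subspace B \<and> vec.dim B = vec.dim X}"
  have eq: "card {g \<in> GL. g ` X = B} = card {g \<in> GL. g ` X = A}" if "B \<in> ?Gr" for B
  proof -
    have le: "card {g \<in> GL. g ` X = B} \<le> card {g \<in> GL. g ` X = A}"
      if AB: "vec.subspace A" "vec.subspace B" "vec.dim A = vec.dim B" for A B :: "('a ^ 'n) set"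
    proof -
      obtain h where h: "h \<in> GL" "h ` B = A" using GL_transitive[of B A] AB by metis
      have "inj_on (\<lambda>g. h \<circ> g) {g \<in> GL. g ` X = B}"
      proof (rule inj_onI)
        fix g g' assume "h \<circ> g = h \<circ> g'"
        then have "h (g x) = h (g' x)" for x by (metis comp_apply)
        moreover have "inj h" using h by (simp add: GL_def bij_def)
        ultimately show "g = g'" by (intro ext) (simp add: inj_eq)
      qed
      moreover have "(\<lambda>g. h \<circ> g) ` {g \<in> GL. g ` X = B} \<subseteq> {g \<in> GL. g ` X = A}"
        using h GL_comp[OF h(1)] by (auto simp: image_comp[symmetric])
      ultimately show ?thesis by (rule card_inj_on_le) auto
    qed
    show ?thesis using that assms by (intro antisym le) auto
  qed
  have "GL = (\<Union>B\<in>?Gr. {g \<in> GL. g ` X = B})"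
    using assms(1) by (auto simp: GL_image)
  then have "card (GL :: (('a ^ 'n) \<Rightarrow> ('a ^ 'n)) set) = card (\<Union>B\<in>?Gr. {g \<in> GL. g ` X = B})"
    by simp
  also have "\<dots> = (\<Sum>B\<in>?Gr. card {g \<in> GL. g ` X = B})"
    by (rule card_UN_disjoint) auto
  also have "\<dots> = card ?Gr * card {g \<in> GL. g ` X = A}" using eq by simp
  finally show ?thesis using card_subspaces_dim[where 'a='a and 'n='n, of "vec.dim X"] by simp
qed

lemma gaussian_binomial_pos:
  assumes "q \<ge> 2" "k \<le> n"
  shows "gaussian_binomial q n k > 0"
proof -
  have "real q ^ i - 1 > 0" if "i > 0" for i
    using that assms(1) one_less_power[of "real q" i] by simp
  then show ?thesis using assms unfolding gaussian_binomial_def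
    by (intro divide_pos_pos prod_pos) auto
qed

lemma gaussian_binomial_nonneg:
  assumes "q \<ge> 2"
  shows "gaussian_binomial q n k \<ge> 0"
proof (cases "k \<le> n")
  case True
  then show ?thesis using gaussian_binomial_pos[OF assms] by (simp add: less_imp_le)
next
  case False
  then have "(\<Prod>i<k. real q ^ (n - i) - 1) = 0" by (intro prod_zero) (auto intro!: bexI[of _ n])
  then show ?thesis unfolding gaussian_binomial_def by (simp only: div_0 order_refl)
qed

text \<open>
  Pairs \<open>(X, g)\<close> with \<open>X \<in> C\<close>, \<open>g \<in> GL\<close> and \<open>g ` X \<in> F\<close> are counted in two ways. For fixed \<open>X\<close>
  the proportion of such \<open>g\<close> is the proportion of subspaces of dimension \<open>dim X\<close> that belong to
  \<open>F\<close>; for fixed \<open>g\<close> there is at most one \<open>X\<close>, because \<open>g\<close> preserves distances and the elements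
  of \<open>C\<close> are too far apart for two of them to land in \<open>F\<close>.
\<close>

lemma sum_level_le_1:
  fixes F C :: "('a::{field,finite} ^ 'n) set set"
  assumes "diam_le d F"
    and C: "\<And>X. X \<in> C \<Longrightarrow> vec.subspace X"
    and far: "\<And>X Y. X \<in> C \<Longrightarrow> Y \<in> C \<Longrightarrow> X \<noteq> Y \<Longrightarrow> d + 2 * vec.dim (X \<inter> Y) < vec.dim X + vec.dim Y"
  shows "(\<Sum>X\<in>C. real (card (level F (vec.dim X))) / gaussian_binomial CARD('a) CARD('n) (vec.dim X)) \<le> 1"
proof -
  let ?G = "GL :: (('a ^ 'n) \<Rightarrow> ('a ^ 'n)) set"
  let ?gb = "gaussian_binomial CARD('a) CARD('n)"
  have q: "CARD('a) \<ge> 2" by (rule card_field_ge2)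
  have sub: "vec.subspace A" if "A \<in> F" for A using that assms(1) by (auto simp: diam_le_def)
  have "id \<in> ?G" by (auto simp: GL_def vec.linear_id)
  then have G: "card ?G > 0" by (auto simp: card_gt_0_iff)
  have share: "real (card (level F (vec.dim X))) / ?gb (vec.dim X) * card ?G = card {g \<in> ?G. g ` X \<in> F}"
    if X: "X \<in> C" for X
  proof -
    have pos: "?gb (vec.dim X) > 0"
      using vec.dim_subset_UNIV[of X] by (intro gaussian_binomial_pos q) (simp add: card_cart_basis vec.dimension_def)
    have "{g \<in> ?G. g ` X \<in> F} = (\<Union>A\<in>level F (vec.dim X). {g \<in> ?G. g ` X = A})"
      by (auto simp: level_def GL_image)
    then have "card {g \<in> ?G. g ` X \<in> F} = card (\<Union>A\<in>level F (vec.dim X). {g \<in> ?G. g ` X = A})"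
      by simp
    also have "\<dots> = (\<Sum>A\<in>level F (vec.dim X). card {g \<in> ?G. g ` X = A})"
      by (rule card_UN_disjoint) auto
    finally have "real (card {g \<in> ?G. g ` X \<in> F}) = (\<Sum>A\<in>level F (vec.dim X). real (card {g \<in> ?G. g ` X = A}))"
      by simp
    also have "\<dots> = (\<Sum>A\<in>level F (vec.dim X). real (card ?G) / ?gb (vec.dim X))"
    proof (rule sum.cong[OF refl])
      fix A assume "A \<in> level F (vec.dim X)"
      then have "real (card {g \<in> ?G. g ` X = A}) * ?gb (vec.dim X) = card ?G"
        using card_GL_carrying[of X A] C[OF X] sub by (auto simp: level_def)
      then show "real (card {g \<in> ?G. g ` X = A}) = real (card ?G) / ?gb (vec.dim X)"
        using pos by (simp add: field_simps)
    qed
    finally show ?thesis by simp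
  qed
  have one: "card {X \<in> C. g ` X \<in> F} \<le> 1" if g: "g \<in> ?G" for g
  proof -
    have "X = Y" if "X \<in> C" "Y \<in> C" "g ` X \<in> F" "g ` Y \<in> F" for X Y
    proof (rule ccontr)
      assume "X \<noteq> Y"
      from far[OF that(1,2) this] show False
        using assms(1) that(3,4) GL_image(2)[OF g] unfolding diam_le_def
        by (metis GL_image(3)[OF g] not_less)
    qed
    then have "is_singleton {X \<in> C. g ` X \<in> F} \<or> {X \<in> C. g ` X \<in> F} = {}"
      by (smt (verit, best) Collect_empty_eq is_singletonI' mem_Collect_eq)
    then show ?thesis by (elim disjE) (simp_all only: is_singleton_altdef card.empty)
  qed
  have "(\<Sum>X\<in>C. real (card (level F (vec.dim X))) / ?gb (vec.dim X)) * card ?G =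
      (\<Sum>X\<in>C. real (card {g \<in> ?G. g ` X \<in> F}))"
    using share by (simp add: sum_distrib_right)
  also have "\<dots> = real (\<Sum>g\<in>?G. card {X \<in> C. g ` X \<in> F})"
    using sum_card_swap[of C ?G "\<lambda>X g. g ` X \<in> F"] by (simp flip: of_nat_sum)
  also have "\<dots> \<le> real (card ?G)"
    using sum_mono[OF one, of ?G] by (simp flip: of_nat_sum)
  finally show ?thesis using G by simp
qed

lemma card_level_le_code:
  fixes F C :: "('a::{field,finite} ^ 'n) set set"
  assumes "diam_le d F" "k \<le> CARD('n)"
    and C: "\<And>X. X \<in> C \<Longrightarrow> vec.subspace X \<and> vec.dim X = k"
    and far: "\<And>X Y. X \<in> C \<Longrightarrow> Y \<in> C \<Longrightarrow> X \<noteq> Y \<Longrightarrow> d + 2 * vec.dim (X \<inter> Y) < 2 * k"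
  shows "real (card C) * real (card (level F k)) \<le> gaussian_binomial CARD('a) CARD('n) k"
proof -
  have "(\<Sum>X\<in>C. real (card (level F (vec.dim X))) / gaussian_binomial CARD('a) CARD('n) (vec.dim X)) \<le> 1"
    using assms by (intro sum_level_le_1[of d]) (auto simp flip: mult_2)
  then have "real (card C) * (real (card (level F k)) / gaussian_binomial CARD('a) CARD('n) k) \<le> 1"
    using C by simp
  then show ?thesis
    using gaussian_binomial_pos[OF card_field_ge2[where 'a='a] assms(2)] by (simp add: field_simps)
qed

lemma gaussian_binomial_symmetric:
  assumes "k \<le> CARD('n)"
  shows "gaussian_binomial CARD('a::{field,finite}) CARD('n::finite) (CARD('n) - k) = gaussian_binomial CARD('a) CARD('n) k"
proof -
  let ?V = "{A :: ('a ^ 'n) set. vec.subspace A}"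
  have lev: "level ?V k = {A. vec.subspace A \<and> vec.dim A = k}" for k by (auto simp: level_def)
  have "perp ` ?V = ?V"
    by (auto simp: image_iff) (metis perp_perp subspace_perp)
  then have "card (level ?V k) = card (level ?V (CARD('n) - k))"
    using card_level_perp[of ?V k] assms by simp
  then show ?thesis by (simp only: lev flip: card_subspaces_dim)
qed

lemma complement_exists:
  assumes "k \<le> CARD('n)"
  obtains X Y :: "('a::{field,finite} ^ 'n) set" where "vec.subspace X" "vec.subspace Y"
    "vec.dim X = k" "vec.dim Y = CARD('n) - k" "vec.dim (X \<inter> Y) = 0"
proof -
  let ?E = "cart_basis :: ('a ^ 'n) set"
  obtain B where B: "B \<subseteq> ?E" "card B = k"
    using obtain_subset_with_card_n[of k ?E] assms by (auto simp: card_cart_basis)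
  have ind: "vec.independent B" "vec.independent (?E - B)"
    using vec.independent_mono[OF independent_cart_basis] B by auto
  have X: "vec.dim (vec.span B) = k" using ind B by (simp add: vec.dim_span_eq_card_independent del: vec.dim_span)
  have Y: "vec.dim (vec.span (?E - B)) = CARD('n) - k"
    using ind B finite_subset[OF B(1) finite_cart_basis]
    by (simp add: vec.dim_span_eq_card_independent card_Diff_subset card_cart_basis del: vec.dim_span)
  have "?E \<subseteq> vec.span (vec.span B \<union> vec.span (?E - B))"
    using B by (auto intro!: vec.span_base)
  then have "vec.span (vec.span B \<union> vec.span (?E - B)) = UNIV"
    using vec.span_minimal[of ?E "vec.span (vec.span B \<union> vec.span (?E - B))"] by (simp add: span_cart_basis top_unique)
  then have "vec.dim (vec.span B \<inter> vec.span (?E - B)) = 0"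
    using dim_sum_span[of "vec.span B" "vec.span (?E - B)"] X Y assms by (simp add: vec_dim_UNIV del: vec.dim_UNIV vec.dim_span vec.dim_eq_0)
  then show ?thesis using X Y that[of "vec.span B" "vec.span (?E - B)"] by (simp del: vec.dim_span vec.dim_eq_0)
qed

lemma card_complementary_levels:
  fixes F :: "('a::{field,finite} ^ 'n) set set"
  assumes "diam_le d F" "CARD('n) = d + 1" "k \<le> CARD('n)" "k \<noteq> CARD('n) - k"
  shows "real (card (level F k)) + real (card (level F (CARD('n) - k))) \<le> gaussian_binomial CARD('a) CARD('n) k"
proof -
  obtain X Y :: "('a ^ 'n) set" where XY: "vec.subspace X" "vec.subspace Y"
    "vec.dim X = k" "vec.dim Y = CARD('n) - k" "vec.dim (X \<inter> Y) = 0"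
    using complement_exists[OF assms(3)] by metis
  then have ne: "X \<noteq> Y" using assms(4) by auto
  have "(\<Sum>Z\<in>{X, Y}. real (card (level F (vec.dim Z))) / gaussian_binomial CARD('a) CARD('n) (vec.dim Z)) \<le> 1"
    using XY assms by (intro sum_level_le_1[OF assms(1)]) (auto simp: Int_commute simp del: vec.dim_eq_0)
  then show ?thesis using ne XY gaussian_binomial_pos[OF card_field_ge2[where 'a='a] assms(3)]
    by (simp add: gaussian_binomial_symmetric[OF assms(3)] field_simps del: vec.dim_eq_0)
qed

section \<open>Rank-metric codes\<close>

lemma field_power_card: "x ^ CARD('a) = x" for x :: "'a::{field,finite}"
proof (cases "x = 0")
  case False
  have "(\<Prod>y\<in>UNIV-{0}. x * y) = (\<Prod>y\<in>UNIV-{0}. y)"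
    by (rule prod.reindex_bij_witness[of _ "\<lambda>y. y / x" "\<lambda>y. x * y"]) (use False in auto)
  then have "x ^ (CARD('a) - 1) * (\<Prod>y\<in>UNIV-{0::'a}. y) = (\<Prod>y\<in>UNIV-{0}. y)"
    by (simp add: prod.distrib card_Diff_subset)
  then have "x ^ (CARD('a) - 1) = 1" by simp
  moreover have "CARD('a) = Suc (CARD('a) - 1)" using card_field_ge2[where 'a='a] by simp
  ultimately show ?thesis by (metis mult.right_neutral power_Suc)
qed (use card_field_ge2[where 'a='a] in auto)

text \<open>
  As \<open>x ^ q = x\<close> on the field, the polynomial \<open>(x + 1) ^ q - x ^ q - 1\<close> vanishes at all \<open>q\<close>
  points, but its degree is less than \<open>q\<close>, so its coefficients are zero. This makes \<open>x \<mapsto> x ^ q\<close>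
  additive in every extension of the field.
\<close>

lemma of_nat_card_choose:
  assumes "0 < i" "i < CARD('a::{field,finite})"
  shows "of_nat (CARD('a) choose i) = (0 :: 'a)"
proof -
  let ?q = "CARD('a)"
  define P :: "'a poly" where "P = (\<Sum>j\<in>{1..<?q}. Polynomial.monom (of_nat (?q choose j)) j)"
  have q: "?q \<ge> 2" by (rule card_field_ge2)
  have root: "poly P x = 0" for x
  proof -
    have "{..?q} = insert 0 (insert ?q {1..<?q})" using q by auto
    then have "(x + 1) ^ ?q = 1 + (x ^ ?q + (\<Sum>j\<in>{1..<?q}. of_nat (?q choose j) * x ^ j))"
      using q by (simp add: binomial_ring[of x 1])
    then show ?thesis by (simp add: P_def poly_sum poly_monom field_power_card)
  qed
  have deg: "Polynomial.degree P < ?q"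
  proof -
    have "Polynomial.degree P \<le> ?q - 1" unfolding P_def
      by (intro degree_sum_le) (auto intro: order_trans[OF degree_monom_le])
    then show ?thesis using q by simp
  qed
  have "P = 0"
  proof (rule ccontr)
    assume "P \<noteq> 0"
    then have "card {x. poly P x = 0} \<le> Polynomial.degree P"
      by (rule card_poly_roots_bound)
    then show False using root deg by simp
  qed
  then have "Polynomial.coeff P i = 0" by simp
  then show ?thesis using assms by (simp add: P_def coeff_sum)
qed

lemma of_nat_card_field: "of_nat CARD('a) = (0 :: 'a::{field,finite})"
proof -
  have "of_nat (CARD('a) choose 1) = (0 :: 'a)"
    by (rule of_nat_card_choose) (use card_field_ge2[where 'a='a] in linarith)+
  then show ?thesis by (simp only: choose_one)
qed

lemma frobenius_add:
  "(x + y) ^ CARD('a) = x ^ CARD('a) + y ^ CARD('a)" for x y :: "'a::{field,finite} alg_closure"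
proof -
  let ?q = "CARD('a)"
  have q: "?q \<ge> 2" by (rule card_field_ge2)
  have "of_nat (?q choose j) = (0 :: 'a alg_closure)" if "j \<in> {1..<?q}" for j
    using of_nat_card_choose[of j, where 'a='a] that by (metis Suc_le_eq One_nat_def atLeastLessThan_iff to_ac_0 to_ac_of_nat)
  moreover have "{..?q} = insert 0 (insert ?q {1..<?q})" using q by auto
  ultimately show ?thesis using q by (simp add: binomial_ring[of x y])
qed

lemma frobenius_iter_add:
  "(x + y) ^ (CARD('a) ^ i) = x ^ (CARD('a) ^ i) + y ^ (CARD('a) ^ i)" for x y :: "'a::{field,finite} alg_closure"
proof (induction i arbitrary: x y)
  case (Suc i)
  have "(x + y) ^ (CARD('a) ^ Suc i) = (x ^ CARD('a) + y ^ CARD('a)) ^ (CARD('a) ^ i)"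
    unfolding power_Suc[of "CARD('a)"] power_mult frobenius_add ..
  also have "\<dots> = (x ^ CARD('a)) ^ (CARD('a) ^ i) + (y ^ CARD('a)) ^ (CARD('a) ^ i)"
    by (rule Suc.IH)
  finally show ?case unfolding power_Suc[of "CARD('a)"] power_mult .
qed simp

lemma to_ac_power_card: "to_ac c ^ (CARD('a) ^ i) = to_ac c" for c :: "'a::{field,finite}"
proof -
  have "c ^ (CARD('a) ^ i) = c"
  proof (induction i)
    case (Suc i)
    then show ?case unfolding power_Suc[of "CARD('a)"] power_mult field_power_card .
  qed simp
  then show ?thesis by (metis to_ac_power)
qed

text \<open>
  For positive \<open>l\<close> this is the subfield with \<open>q ^ l\<close> elements. For \<open>l = 0\<close> it is the whole
  algebraic closure.
\<close>

definition subfield_of_degree :: "nat \<Rightarrow> 'a::{field,finite} alg_closure set" where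
  "subfield_of_degree l = {x. x ^ (CARD('a) ^ l) = x}"

text \<open>
  The derivative of \<open>x ^ Q - x\<close> is \<open>-1\<close>, hence its roots are simple, and over the algebraic
  closure their number is the degree.
\<close>

lemma card_subfield_of_degree:
  assumes "l > 0"
  shows "card (subfield_of_degree l :: 'a::{field,finite} alg_closure set) = CARD('a) ^ l"
proof -
  let ?Q = "CARD('a) ^ l"
  have Q: "?Q > 1" using card_field_ge2[where 'a='a] assms by (intro one_less_power) auto
  define p :: "'a alg_closure poly" where "p = Polynomial.monom 1 ?Q + [:0, -1:]"
  have roots: "subfield_of_degree l = {x. poly p x = 0}"
    by (auto simp: subfield_of_degree_def p_def poly_monom)
  have "Polynomial.degree [:0, -1 :: 'a alg_closure:] < Polynomial.degree (Polynomial.monom (1 :: 'a alg_closure) ?Q)"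
    using Q by (simp add: degree_monom_eq)
  then have deg: "Polynomial.degree p = ?Q" and lead: "p \<noteq> 0"
    using degree_add_eq_left[of "[:0, -1 :: 'a alg_closure:]" "Polynomial.monom 1 ?Q"] Q
    by (auto simp: p_def degree_monom_eq)
  have "of_nat ?Q = (0 :: 'a alg_closure)"
    using assms of_nat_card_field[where 'a='a] by (simp add: zero_power flip: to_ac_of_nat)
  then have der: "pderiv p = -1"
    by (simp add: p_def pderiv_add pderiv_monom pderiv_pCons one_pCons)
  obtain A where A: "size A = Polynomial.degree p" "p = Polynomial.smult (Polynomial.lead_coeff p) (\<Prod>x\<in>#A. [:-x, 1:])"
    using alg_closed_imp_factorization[OF lead] by blast
  have "count A x \<le> 1" for x
  proof (rule ccontr)
    assume "\<not> count A x \<le> 1"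
    then have "x \<in># A" by (auto simp: not_le simp flip: count_greater_zero_iff)
    then obtain A1 where A1: "A = add_mset x A1" by (meson multi_member_split)
    with \<open>\<not> count A x \<le> 1\<close> have "x \<in># A1" by (auto simp flip: count_greater_zero_iff)
    then obtain A' where "A1 = add_mset x A'" by (meson multi_member_split)
    with A1 have A': "A = add_mset x (add_mset x A')" by simp
    define r where "r = Polynomial.smult (Polynomial.lead_coeff p) (\<Prod>x\<in>#A'. [:-x, 1:])"
    have "p = [:-x, 1:] * ([:-x, 1:] * r)"
      unfolding r_def by (subst A(2)) (simp only: A' image_mset_add_mset prod_mset.add_mset mult_smult_right)
    then have "pderiv p = pderiv ([:-x, 1:] * ([:-x, 1:] * r))" by (rule arg_cong)
    then have "poly (pderiv p) x = 0" by (simp only: pderiv_mult poly_add poly_mult) simp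
    then show False by (simp add: der)
  qed
  then have "A = mset_set (set_mset A)"
    by (intro multiset_eqI) (auto simp: count_mset_set' intro: antisym simp flip: count_eq_zero_iff)
  then have "size A = card (set_mset A)" by (metis size_mset_set)
  moreover have "set_mset A = {x. poly p x = 0}"
    using lead by (subst A(2)) (auto simp: poly_prod_mset)
  ultimately show ?thesis using A deg roots by simp
qed

lemma vector_space_ac: "vector_space (\<lambda>(c :: 'a::field) x. to_ac c * x)"
  by unfold_locales (auto simp: algebra_simps)

lemma subfield_basis:
  assumes "l > 0"
  obtains B :: "'a::{field,finite} alg_closure set" where "finite B" "card B = l"
    "\<not> module.dependent (\<lambda>(c :: 'a) x. to_ac c * x) B"
    "module.span (\<lambda>(c :: 'a) x. to_ac c * x) B = subfield_of_degree l"
proof -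
  interpret ac: vector_space "\<lambda>(c :: 'a) x. to_ac c * x" by (rule vector_space_ac)
  let ?K = "subfield_of_degree l :: 'a alg_closure set"
  have q: "CARD('a) \<ge> 2" by (rule card_field_ge2)
  have "card ?K > 0" using card_subfield_of_degree[OF assms, where 'a='a] q by simp
  then have fin: "finite ?K" using card_gt_0_iff by blast
  have "ac.subspace ?K"
    unfolding ac.subspace_def using q
    by (auto simp: subfield_of_degree_def frobenius_iter_add power_mult_distrib to_ac_power_card)
  moreover obtain B where B: "B \<subseteq> ?K" "ac.independent B" "?K \<subseteq> ac.span B"
    using ac.maximal_independent_subset by metis
  ultimately have sp: "ac.span B = ?K" using ac.span_minimal by blast
  have fB: "finite B" using B fin finite_subset by blast
  then have "CARD('a) ^ card B = CARD('a) ^ l"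
    using card_span_independent[OF vector_space_ac fB B(2)] sp card_subfield_of_degree[OF assms, where 'a='a] by simp
  then have "card B = l" using q by simp
  then show ?thesis using that B(2) fB sp by blast
qed

text \<open>
  The difference of the two sides is a nonzero polynomial of degree at most \<open>q ^ (r - 1)\<close>.
\<close>

lemma linearized_poly_roots:
  fixes c c' :: "nat \<Rightarrow> 'a::{field,finite} alg_closure"
  assumes "i < r" "c i \<noteq> c' i"
  shows "finite {x. (\<Sum>i<r. c i * x ^ (CARD('a) ^ i)) = (\<Sum>i<r. c' i * x ^ (CARD('a) ^ i))}"
    and "card {x. (\<Sum>i<r. c i * x ^ (CARD('a) ^ i)) = (\<Sum>i<r. c' i * x ^ (CARD('a) ^ i))} \<le> CARD('a) ^ (r - 1)"
proof -
  let ?q = "CARD('a)"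
  have q: "?q \<ge> 2" by (rule card_field_ge2)
  define P where "P = (\<Sum>i<r. Polynomial.monom (c i - c' i) (?q ^ i))"
  have roots: "{x. (\<Sum>i<r. c i * x ^ (?q ^ i)) = (\<Sum>i<r. c' i * x ^ (?q ^ i))} = {x. poly P x = 0}"
    by (simp add: P_def poly_sum poly_monom algebra_simps sum_subtractf)
  have "Polynomial.coeff P (?q ^ i) = (\<Sum>j<r. if j = i then c j - c' j else 0)"
    unfolding P_def coeff_sum using q by (intro sum.cong) auto
  also have "\<dots> = c i - c' i" using assms by simp
  finally have "P \<noteq> 0" using assms by auto
  moreover have "Polynomial.degree P \<le> ?q ^ (r - 1)" unfolding P_def
    using q by (intro degree_sum_le) (auto intro!: order_trans[OF degree_monom_le] power_increasing)
  ultimately show "finite {x. (\<Sum>i<r. c i * x ^ (?q ^ i)) = (\<Sum>i<r. c' i * x ^ (?q ^ i))}"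
    "card {x. (\<Sum>i<r. c i * x ^ (?q ^ i)) = (\<Sum>i<r. c' i * x ^ (?q ^ i))} \<le> ?q ^ (r - 1)"
    unfolding roots using card_poly_roots_bound[of P] poly_roots_finite[of P] by simp_all
qed

text \<open>
  The map that sends a vector to the combination of independent elements \<open>\<tau> i\<close> of the algebraic
  closure with its coordinates in \<open>I\<close> as coefficients. It identifies the coordinates in \<open>I\<close> with
  a subspace of the closure.
\<close>

lemma coordinates_map:
  fixes \<tau> :: "'n::finite \<Rightarrow> 'a::{field,finite} alg_closure"
  assumes "inj_on \<tau> I" "\<tau> ` I \<subseteq> B" "\<not> module.dependent (\<lambda>(c :: 'a) x. to_ac c * x) B"
    and \<psi>_def: "\<psi> = (\<lambda>v :: 'a ^ 'n. \<Sum>i\<in>I. to_ac (v $ i) * \<tau> i)"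
  shows "\<psi> v = \<psi> w \<longleftrightarrow> (\<forall>i\<in>I. v $ i = w $ i)"
    and "range \<psi> = module.span (\<lambda>(c :: 'a) x. to_ac c * x) (\<tau> ` I)"
    and "card (range \<psi>) = CARD('a) ^ card I"
proof -
  interpret ac: vector_space "\<lambda>(c :: 'a) x. to_ac c * x" by (rule vector_space_ac)
  have ind: "ac.independent (\<tau> ` I)" by (rule ac.independent_mono[OF assms(3,2)])
  show eq: "\<psi> v = \<psi> w \<longleftrightarrow> (\<forall>i\<in>I. v $ i = w $ i)" for v w
  proof
    assume "\<psi> v = \<psi> w"
    then have "(\<Sum>i\<in>I. to_ac (v $ i - w $ i) * \<tau> i) = 0"
      by (simp add: \<psi>_def algebra_simps sum_subtractf)
    also have "(\<Sum>i\<in>I. to_ac (v $ i - w $ i) * \<tau> i) =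
        (\<Sum>b\<in>\<tau> ` I. to_ac (v $ the_inv_into I \<tau> b - w $ the_inv_into I \<tau> b) * b)"
      by (subst sum.reindex[OF assms(1)]) (simp add: the_inv_into_f_f[OF assms(1)])
    finally have "(\<Sum>b\<in>\<tau> ` I. to_ac (v $ the_inv_into I \<tau> b - w $ the_inv_into I \<tau> b) * b) = 0" .
    from ac.independentD[OF ind _ subset_refl this]
    have "v $ the_inv_into I \<tau> (\<tau> i) - w $ the_inv_into I \<tau> (\<tau> i) = 0" if "i \<in> I" for i
      using that by simp
    then show "\<forall>i\<in>I. v $ i = w $ i" by (simp add: the_inv_into_f_f[OF assms(1)])
  qed (simp add: \<psi>_def)
  show rng: "range \<psi> = ac.span (\<tau> ` I)"
  proof (subst ac.span_finite, simp, intro subset_antisym subsetI)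
    fix z assume "z \<in> range \<psi>"
    then obtain v where "z = \<psi> v" by auto
    then have "z = (\<Sum>b\<in>\<tau> ` I. to_ac (v $ the_inv_into I \<tau> b) * b)"
      by (subst sum.reindex[OF assms(1)]) (simp add: the_inv_into_f_f[OF assms(1)] \<psi>_def)
    then show "z \<in> range (\<lambda>u. \<Sum>b\<in>\<tau> ` I. to_ac (u b) * b)" by (intro image_eqI[of _ _ "\<lambda>b. v $ the_inv_into I \<tau> b"]) auto
  next
    fix z assume "z \<in> range (\<lambda>u. \<Sum>b\<in>\<tau> ` I. to_ac (u b) * b)"
    then obtain u where "z = (\<Sum>b\<in>\<tau> ` I. to_ac (u b) * b)" by auto
    then have "z = \<psi> (\<chi> i. u (\<tau> i))" by (simp add: sum.reindex[OF assms(1)] \<psi>_def)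
    then show "z \<in> range \<psi>" by blast
  qed
  show "card (range \<psi>) = CARD('a) ^ card I"
    using card_span_independent[OF vector_space_ac _ ind] by (simp add: rng card_image[OF assms(1)])
qed

text \<open>
  Gabidulin's construction of a maximum rank distance code. Split the coordinates into a set \<open>I\<close>
  of size \<open>k\<close> and its complement of size \<open>l\<close>, and identify the coordinates outside \<open>I\<close> with the
  field \<open>K\<close> of \<open>q ^ l\<close> elements by \<open>\<phi>\<close> and those inside \<open>I\<close> with a subspace of \<open>K\<close> by \<open>\<psi>\<close>. The
  elements of the code are the graphs \<open>\<phi> v = L (\<psi> v)\<close>, where \<open>L\<close> runs through the linearized
  polynomials with \<open>r\<close> coefficients. Two graphs meet over the common zeros of two such
  polynomials, of which there are at most \<open>q ^ (r - 1)\<close>. The subspace \<open>W\<close> is the vertical one,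
  \<open>\<psi> v = 0\<close>; it meets every graph trivially and completes the code to a spread when \<open>k = l\<close> and
  \<open>r = 1\<close>.
\<close>

theorem rank_metric_code_exists:
  assumes n: "CARD('n::finite) = k + l" and "0 < k" "k \<le> l" "0 < r" "r \<le> k"
  obtains C :: "('a::{field,finite} ^ 'n) set set" and W where
    "card C = CARD('a) ^ (l * r)"
    "\<And>X. X \<in> C \<Longrightarrow> vec.subspace X \<and> vec.dim X = k"
    "\<And>X Y. X \<in> C \<Longrightarrow> Y \<in> C \<Longrightarrow> X \<noteq> Y \<Longrightarrow> vec.dim (X \<inter> Y) < r"
    "vec.subspace W" "vec.dim W = l" "\<And>X. X \<in> C \<Longrightarrow> vec.dim (X \<inter> W) = 0"
proof -
  let ?q = "CARD('a)"
  have q: "?q \<ge> 2" by (rule card_field_ge2)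
  let ?K = "subfield_of_degree l :: 'a alg_closure set"
  obtain B :: "'a alg_closure set" where B: "finite B" "card B = l"
    "\<not> module.dependent (\<lambda>(c :: 'a) x. to_ac c * x) B"
    "module.span (\<lambda>(c :: 'a) x. to_ac c * x) B = ?K"
    using subfield_basis[of l] assms by (metis less_le_trans)
  obtain I :: "'n set" where I: "card I = k" using obtain_subset_with_card_n[of k "UNIV :: 'n set"] n by auto
  have J: "card (- I) = l" using n I by (simp add: Compl_eq_Diff_UNIV card_Diff_subset)
  obtain \<tau> where \<tau>: "inj_on \<tau> I" "\<tau> ` I \<subseteq> B"
    using card_le_inj[of I B] B I assms by auto
  obtain \<sigma> where \<sigma>: "bij_betw \<sigma> (- I) B"
    using finite_same_card_bij[of "- I" B] B J by auto
  \<comment> \<open>Here the hypothesis \<open>k \<le> l\<close> enters: \<open>\<tau>\<close> must be injective for \<open>\<psi>\<close> to be injective on the coordinates in \<open>I\<close>.\<close>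
  define \<psi> where "\<psi> = (\<lambda>v :: 'a ^ 'n. \<Sum>i\<in>I. to_ac (v $ i) * \<tau> i)"
  define \<phi> where "\<phi> = (\<lambda>v :: 'a ^ 'n. \<Sum>i\<in>-I. to_ac (v $ i) * \<sigma> i)"
  note cI = coordinates_map[OF \<tau> B(3) \<psi>_def]
  have \<sigma>': "inj_on \<sigma> (- I)" "\<sigma> ` (- I) \<subseteq> B" using \<sigma> by (auto simp: bij_betw_def)
  note cJ = coordinates_map[OF \<sigma>' B(3) \<phi>_def]
  have rng: "range \<phi> = ?K" using cJ(2) \<sigma> B by (simp add: bij_betw_def)
  have lin: "\<psi> (v + w) = \<psi> v + \<psi> w" "\<phi> (v + w) = \<phi> v + \<phi> w"
    "\<psi> (a *s v) = to_ac a * \<psi> v" "\<phi> (a *s v) = to_ac a * \<phi> v" "\<psi> 0 = 0" "\<phi> 0 = 0" for v w a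
    by (simp_all add: \<psi>_def \<phi>_def algebra_simps sum.distrib sum_distrib_left)
  have inj: "v = w" if "\<psi> v = \<psi> w" "\<phi> v = \<phi> w" for v w
    using that unfolding cI(1) cJ(1) vec_eq_iff by blast
  have ex: "\<exists>v. \<psi> v = \<psi> w \<and> \<phi> v = z" if "z \<in> ?K" for w z
  proof -
    have "z \<in> range \<phi>" unfolding rng by (rule that)
    then obtain u where u: "\<phi> u = z" by blast
    let ?v = "\<chi> i. if i \<in> I then w $ i else u $ i"
    have "\<psi> ?v = \<psi> w" "\<phi> ?v = \<phi> u" unfolding cI(1) cJ(1) by simp_all
    then show ?thesis using u by blast
  qed
  have \<psi>K: "\<psi> v \<in> ?K" for v
  proof -
    interpret ac: vector_space "\<lambda>(c :: 'a) x. to_ac c * x" by (rule vector_space_ac)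
    have "\<psi> v \<in> ac.span (\<tau> ` I)" using cI(2) by blast
    then show ?thesis using ac.span_mono[OF \<tau>(2)] B by auto
  qed
  have K: "x + y \<in> ?K" "x * y \<in> ?K" "x ^ j \<in> ?K" "0 \<in> ?K" if "x \<in> ?K" "y \<in> ?K" for x y j
    using that q by (auto simp: subfield_of_degree_def frobenius_iter_add power_mult_distrib
        power_commutes simp flip: power_mult) (metis mult.commute power_mult)
  define L where "L = (\<lambda>(c :: nat \<Rightarrow> 'a alg_closure) x. \<Sum>i<r. c i * x ^ (?q ^ i))"
  have L_lin: "L c (x + y) = L c x + L c y" "L c (to_ac a * x) = to_ac a * L c x" for c x y a
    using q by (simp_all add: L_def frobenius_iter_add algebra_simps sum.distrib power_mult_distrib
        to_ac_power_card sum_distrib_left)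
  have L_0: "L c 0 = 0" for c using L_lin(2)[of c 0 0] by simp
  define A where "A = (\<lambda>c. {v. \<phi> v = L c (\<psi> v)})"
  let ?P = "PiE {..<r} (\<lambda>_. ?K)"
  have LK: "L c x \<in> ?K" if "c \<in> ?P" "x \<in> ?K" for c x
  proof -
    have "(\<Sum>i<m. c i * x ^ (?q ^ i)) \<in> ?K" if "m \<le> r" for m
      using that
    proof (induction m)
      case (Suc m)
      have "c m \<in> ?K" by (rule PiE_mem[OF \<open>c \<in> ?P\<close>]) (use Suc.prems in simp)
      then show ?case using Suc K \<open>x \<in> ?K\<close> by simp
    next
      case 0
      show ?case using K(4)[OF \<open>x \<in> ?K\<close> \<open>x \<in> ?K\<close>] by simp
    qed
    then show ?thesis by (simp add: L_def)
  qed
  have subA: "vec.subspace (A c)" for c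
    by (auto simp: vec.subspace_def A_def lin L_lin L_0)
  have dimA: "vec.dim (A c) = k" if c: "c \<in> ?P" for c
  proof -
    have "inj_on \<psi> (A c)" by (rule inj_onI) (auto simp: A_def intro: inj)
    moreover have "\<psi> ` A c = range \<psi>"
    proof (intro subset_antisym subsetI)
      fix z assume "z \<in> range \<psi>"
      then obtain w where "z = \<psi> w" by auto
      moreover obtain v where "\<psi> v = \<psi> w" "\<phi> v = L c (\<psi> w)"
        using ex[of "L c (\<psi> w)" w] LK[OF c \<psi>K] by auto
      ultimately show "z \<in> \<psi> ` A c" by (intro image_eqI[of _ _ v]) (auto simp: A_def)
    qed auto
    ultimately have "card (A c) = ?q ^ k" using cI(3) I card_image by metis
    then show ?thesis using card_subspace[OF subA] q by simp
  qed
  have meet: "vec.dim (A c \<inter> A c') < r" if c: "c \<in> ?P" "c' \<in> ?P" "c \<noteq> c'" for c c'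
  proof -
    obtain i where i: "i < r" "c i \<noteq> c' i" using PiE_ext[OF c(1,2)] c(3) by auto
    let ?R = "{x. L c x = L c' x}"
    have R: "finite ?R" "card ?R \<le> ?q ^ (r - 1)"
      using linearized_poly_roots[of i r c c', OF i] by (simp_all add: L_def)
    have "inj_on \<psi> (A c \<inter> A c')" by (rule inj_onI) (auto simp: A_def intro: inj)
    moreover have "\<psi> ` (A c \<inter> A c') \<subseteq> ?R" by (auto simp: A_def)
    ultimately have "card (A c \<inter> A c') \<le> card ?R" using R(1) by (intro card_inj_on_le)
    then have "vec.dim (A c \<inter> A c') \<le> r - 1"
      using R(2) subA by (subst dim_le_iff_card_le) (auto intro: vec.subspace_inter)
    then show ?thesis using assms by simp
  qed
  have injA: "inj_on A ?P"
  proof (rule inj_onI, rule ccontr)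
    fix c c' assume *: "c \<in> ?P" "c' \<in> ?P" "A c = A c'" "c \<noteq> c'"
    then show False using meet[OF *(1,2,4)] dimA[OF *(1)] assms by simp
  qed
  let ?W = "{v. \<psi> v = 0}"
  have subW: "vec.subspace ?W" by (auto simp: vec.subspace_def lin)
  have "inj_on \<phi> ?W" by (rule inj_onI) (auto intro: inj)
  moreover have "\<phi> ` ?W = ?K"
  proof (intro subset_antisym subsetI)
    fix z assume "z \<in> ?K"
    then obtain v where "\<psi> v = \<psi> 0" "\<phi> v = z" using ex by blast
    then show "z \<in> \<phi> ` ?W" using lin(5) by auto
  qed (use rng in auto)
  ultimately have "card ?W = ?q ^ l"
    using card_image card_subfield_of_degree[of l, where 'a='a] assms by (metis less_le_trans)
  then have dimW: "vec.dim ?W = l" using card_subspace[OF subW] q by simp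
  have "A c \<inter> ?W \<subseteq> {0}" for c
    using inj[of _ 0] by (auto simp: A_def lin L_lin L_0)
  then have W: "vec.dim (A c \<inter> ?W) = 0" for c by simp
  have "card (A ` ?P) = ?q ^ (l * r)"
    using card_image[OF injA] card_subfield_of_degree[of l, where 'a='a] assms
    by (simp add: card_PiE power_mult)
  then show ?thesis
  proof (rule that[of "A ` ?P" ?W])
    show "vec.subspace X \<and> vec.dim X = k" if "X \<in> A ` ?P" for X
      using that subA dimA by (elim imageE) simp
    show "vec.dim (X \<inter> Y) < r" if XY: "X \<in> A ` ?P" "Y \<in> A ` ?P" "X \<noteq> Y" for X Y
    proof -
      obtain c c' where "c \<in> ?P" "c' \<in> ?P" "X = A c" "Y = A c'" using XY(1,2) by (elim imageE)
      then show ?thesis using meet[of c c'] XY(3) by (cases "c = c'") simp_all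
    qed
    show "vec.dim (X \<inter> ?W) = 0" if "X \<in> A ` ?P" for X
      using that W by (elim imageE) (simp only:)
  qed (rule subW dimW)+
qed

section \<open>Gaussian binomial estimates\<close>

lemma gaussian_binomial_altdef:
  "gaussian_binomial q n k = (\<Prod>i<k. (real q ^ (n - i) - 1) / (real q ^ Suc i - 1))"
proof -
  have "(\<Prod>i<k. real q ^ (k - i) - 1) = (\<Prod>i<k. real q ^ Suc i - 1)"
    using prod.nat_diff_reindex[of "\<lambda>i. real q ^ Suc i - 1" k] by (simp add: Suc_diff_Suc)
  then show ?thesis by (simp only: gaussian_binomial_def prod_dividef)
qed

lemma gaussian_binomial_Suc_right:
  assumes "q \<ge> 2"
  shows "gaussian_binomial q n (Suc k) * (real q ^ Suc k - 1) = gaussian_binomial q n k * (real q ^ (n - k) - 1)"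
proof -
  have "real q ^ Suc k > 1" using assms by (intro one_less_power) auto
  then show ?thesis by (simp add: gaussian_binomial_altdef field_simps del: power_Suc)
qed

lemma gaussian_binomial_1: "gaussian_binomial q n 1 = (real q ^ n - 1) / (real q - 1)"
  by (simp add: gaussian_binomial_altdef)

lemma gaussian_binomial_mono:
  assumes "q \<ge> 2" "m \<le> n"
  shows "gaussian_binomial q m 1 \<le> gaussian_binomial q n 1"
  unfolding gaussian_binomial_1 using assms
  by (intro divide_right_mono diff_right_mono power_increasing) auto

lemma gaussian_binomial_1_double:
  assumes "q \<ge> 2" "n > 0"
  shows "2 * gaussian_binomial q (n - 1) 1 \<le> gaussian_binomial q n 1"
proof -
  have "real q ^ n = real q * real q ^ (n - 1)" using assms by (cases n) auto
  moreover have "2 * real q ^ (n - 1) \<le> real q * real q ^ (n - 1)" using assms by (intro mult_right_mono) auto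
  ultimately have "2 * (real q ^ (n - 1) - 1) \<le> real q ^ n - 1" by simp
  then have "2 * (real q ^ (n - 1) - 1) / (real q - 1) \<le> (real q ^ n - 1) / (real q - 1)"
    using assms by (intro divide_right_mono) auto
  then show ?thesis unfolding gaussian_binomial_1 by simp
qed

text \<open>
  This becomes a geometric decay when the last factor is divided out, as it is for a level
  bounded by a rank metric code of size \<open>q ^ ((n - k) * (k - t))\<close>. Each step from \<open>j\<close> to \<open>j + 1\<close>
  costs a factor of at most \<open>q ^ (j + 1) / (q ^ (t + j + 1) - 1)\<close>, and \<open>q ^ t \<ge> 4\<close> makes this at
  most \<open>2 / 7\<close>, with equality for \<open>q = t = 2\<close> and \<open>j = 0\<close>.
\<close>

lemma gaussian_binomial_le_geometric:
  assumes "q \<ge> 2" "t \<ge> 2" "t + j \<le> n"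
  shows "gaussian_binomial q n (t + j) \<le> (2/7) ^ j * gaussian_binomial q n t * real q ^ ((n - (t + j)) * j)"
  using assms(3)
proof (induction j)
  case (Suc j)
  let ?m = "t + j"
  have IH: "gaussian_binomial q n ?m \<le> (2/7) ^ j * gaussian_binomial q n t * real q ^ ((n - ?m) * j)"
    using Suc by simp
  obtain e where e: "n - ?m = Suc e" using Suc.prems by (metis Suc_diff_Suc add_Suc_right less_eq_Suc_le)
  then have e': "n - Suc ?m = e" by simp
  have pos: "real q ^ Suc ?m - 1 > 0" using one_less_power[of "real q" "Suc ?m"] assms by simp
  have gt0: "gaussian_binomial q n t \<ge> 0" "gaussian_binomial q n ?m \<ge> 0"
    by (rule gaussian_binomial_nonneg[OF assms(1)])+
  have key: "real q ^ Suc j \<le> (2/7) * (real q ^ Suc ?m - 1)"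
  proof -
    have "(2::real) ^ 2 \<le> real q ^ t"
      using assms by (intro order_trans[OF power_increasing[of 2 t] power_mono]) auto
    then have "4 * real q ^ Suc j \<le> real q ^ t * real q ^ Suc j" by (intro mult_right_mono) auto
    also have "\<dots> = real q ^ Suc ?m" by (simp add: power_add)
    finally have "4 * real q ^ Suc j \<le> real q ^ Suc ?m" .
    moreover have "real q ^ 1 \<le> real q ^ Suc j" using assms by (intro power_increasing) auto
    then have "real q ^ Suc j \<ge> 2" using assms(1) unfolding power_one_right by linarith
    ultimately show ?thesis by simp
  qed
  have "gaussian_binomial q n (Suc ?m) * (real q ^ Suc ?m - 1) = gaussian_binomial q n ?m * (real q ^ Suc e - 1)"
    using gaussian_binomial_Suc_right[OF assms(1), of n ?m] e by simp
  also have "\<dots> \<le> gaussian_binomial q n ?m * real q ^ Suc e" using gt0 by (intro mult_left_mono) auto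
  also have "\<dots> \<le> ((2/7) ^ j * gaussian_binomial q n t * real q ^ (Suc e * j)) * real q ^ Suc e"
    using IH e by (intro mult_right_mono) auto
  also have "\<dots> = ((2/7) ^ j * gaussian_binomial q n t * real q ^ (e * Suc j)) * real q ^ Suc j"
    by (simp add: power_add algebra_simps)
  also have "\<dots> \<le> ((2/7) ^ j * gaussian_binomial q n t * real q ^ (e * Suc j)) * ((2/7) * (real q ^ Suc ?m - 1))"
    using gt0 by (intro mult_left_mono key) auto
  also have "\<dots> = ((2/7) ^ Suc j * gaussian_binomial q n t * real q ^ (e * Suc j)) * (real q ^ Suc ?m - 1)"
    by simp
  finally have "gaussian_binomial q n (Suc ?m) \<le> (2/7) ^ Suc j * gaussian_binomial q n t * real q ^ (e * Suc j)"
    using pos by (rule mult_right_le_imp_le)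
  then show ?case by (simp only: e' add_Suc_right)
qed simp

text \<open>
  Both sides count the flags of an \<open>x\<close>-dimensional subspace inside a \<open>t\<close>-dimensional one.
\<close>

lemma gaussian_binomial_subset_of_subset:
  assumes "q \<ge> 2" "x \<le> t" "t \<le> n"
  shows "gaussian_binomial q n x * gaussian_binomial q (n - x) (t - x) = gaussian_binomial q n t * gaussian_binomial q t x"
  using assms(2)
proof (induction x)
  case (Suc x)
  have p: "real q ^ i - 1 > 0" if "i > 0" for i
    using one_less_power[of "real q" i] assms that by simp
  obtain m k where mk: "n - x = Suc m" "t - x = Suc k" using Suc.prems assms
    by (metis Suc_diff_Suc Suc_le_lessD less_le_trans)
  then have mk': "n - Suc x = m" "t - Suc x = k" by auto
  have "gaussian_binomial q n (Suc x) * gaussian_binomial q m k * (real q ^ Suc x - 1)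
     = gaussian_binomial q n x * (real q ^ Suc m - 1) * gaussian_binomial q m k"
    using gaussian_binomial_Suc_right[OF assms(1), of n x] mk by simp
  also have "\<dots> = gaussian_binomial q n x * gaussian_binomial q (Suc m) (Suc k) * (real q ^ Suc k - 1)"
    using p[of "Suc k"] by (simp add: gaussian_binomial_Suc_Suc del: power_Suc)
  also have "\<dots> = gaussian_binomial q n t * (gaussian_binomial q t x * (real q ^ (t - x) - 1))"
    using Suc mk by simp
  also have "\<dots> = gaussian_binomial q n t * gaussian_binomial q t (Suc x) * (real q ^ Suc x - 1)"
    using gaussian_binomial_Suc_right[OF assms(1), of t x] by simp
  finally show ?case using p[of "Suc x"] mk' by (simp del: power_Suc)
qed simp

lemma power_diff_1_le:
  assumes "q \<ge> 2" "m \<le> n"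
  shows "(real q ^ m - 1) * real q ^ (n - m) \<le> real q ^ n - 1"
proof -
  have "real q ^ n = real q ^ m * real q ^ (n - m)" using assms by (simp flip: power_add)
  moreover have "1 \<le> real q ^ (n - m)" using assms by simp
  ultimately show ?thesis by (simp add: algebra_simps)
qed

lemma gaussian_binomial_mono_gap:
  assumes "q \<ge> 2" "u \<le> n" "x \<le> u"
  shows "gaussian_binomial q u x * real q ^ (x * (n - u)) \<le> gaussian_binomial q n x"
proof -
  have "gaussian_binomial q u x * real q ^ (x * (n - u)) =
      (\<Prod>i<x. (real q ^ (u - i) - 1) / (real q ^ Suc i - 1) * real q ^ (n - u))"
    by (simp only: gaussian_binomial_altdef prod.distrib prod_constant card_lessThan power_mult mult.commute[of x])
  also have "\<dots> \<le> (\<Prod>i<x. (real q ^ (n - i) - 1) / (real q ^ Suc i - 1))"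
  proof (rule prod_mono, intro conjI)
    fix i assume i: "i \<in> {..<x}"
    have p: "real q ^ Suc i - 1 > 0" using one_less_power[of "real q" "Suc i"] assms by simp
    have "1 \<le> real q ^ (u - i)" using assms by simp
    then show "0 \<le> (real q ^ (u - i) - 1) / (real q ^ Suc i - 1) * real q ^ (n - u)"
      using p by (simp del: power_Suc)
    have "(n - i) - (u - i) = n - u" using i assms by simp
    then have "(real q ^ (u - i) - 1) * real q ^ (n - u) \<le> real q ^ (n - i) - 1"
      using power_diff_1_le[OF assms(1), of "u - i" "n - i"] assms by simp
    then show "(real q ^ (u - i) - 1) / (real q ^ Suc i - 1) * real q ^ (n - u) \<le> (real q ^ (n - i) - 1) / (real q ^ Suc i - 1)"
      using p by (simp add: divide_right_mono del: power_Suc)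
  qed
  finally show ?thesis by (simp add: gaussian_binomial_altdef)
qed

lemma gaussian_binomial_le_power:
  assumes "q \<ge> 2" "x \<le> t"
  shows "gaussian_binomial q t x \<le> real q ^ (x * (t - x + 1))"
proof -
  have "gaussian_binomial q t x = (\<Prod>i<x. (real q ^ (t - i) - 1) / (real q ^ (x - i) - 1))"
    by (simp add: gaussian_binomial_def prod_dividef)
  also have "\<dots> \<le> (\<Prod>i<x. real q ^ (t - x + 1))"
  proof (rule prod_mono, intro conjI)
    fix i assume i: "i \<in> {..<x}"
    have p: "real q ^ (x - i) - 1 > 0" using one_less_power[of "real q" "x - i"] assms i by simp
    have "1 \<le> real q ^ (t - i)" using assms by simp
    then show "0 \<le> (real q ^ (t - i) - 1) / (real q ^ (x - i) - 1)" using p by simp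
    have "real q ^ (t - x) \<le> real q ^ (t - i)" using assms i by (intro power_increasing) auto
    then have "real q ^ (t - x) * (real q - 1) \<le> real q ^ (t - i) * (real q - 1)"
      using assms by (intro mult_right_mono) auto
    moreover have "2 * real q ^ (t - i) \<le> real q * real q ^ (t - i)" using assms by (intro mult_right_mono) auto
    moreover have "real q ^ (t - x + 1) * real q ^ (x - i) = real q * real q ^ (t - i)"
      using assms i by (simp flip: power_add power_Suc) 
    moreover have "real q ^ (t - x + 1) \<le> real q ^ (t - i)" using assms i by (intro power_increasing) auto
    ultimately have "real q ^ (t - i) - 1 \<le> real q ^ (t - x + 1) * (real q ^ (x - i) - 1)"
      unfolding right_diff_distrib mult_1_right by linarith
    then show "(real q ^ (t - i) - 1) / (real q ^ (x - i) - 1) \<le> real q ^ (t - x + 1)"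
      using p by (simp add: divide_le_eq)
  qed
  also have "\<dots> = real q ^ (x * (t - x + 1))" by (simp only: prod_constant card_lessThan power_mult[symmetric] mult.commute[of x])
  finally show ?thesis .
qed

text \<open>
  The product on the left bounds the number of \<open>t\<close>-dimensional subspaces that meet a fixed
  \<open>u\<close>-dimensional one in dimension at least \<open>x\<close>. Its ratio to \<open>[n, t]\<close> is
  \<open>[u, x] * [t, x] / [n, x]\<close>, which is at most \<open>q ^ (x * (t - x + 1) - x * (n - u))\<close>. The
  hypotheses give \<open>n - u \<ge> (t - x + 1) + (d - x)\<close>, so the ratio is at most
  \<open>q ^ (- x * (d - x))\<close>, and \<open>x * (d - x) \<ge> 3\<close>.
\<close>

lemma gaussian_binomial_meeting_le:
  assumes "q \<ge> 2" "t \<ge> 2" "2 * t \<le> d" "2 * d < n" "1 \<le> x" "x \<le> t" "x \<le> u" "u + t \<le> d + 2 * x"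
  shows "8 * (gaussian_binomial q u x * gaussian_binomial q (n - x) (t - x)) \<le> gaussian_binomial q n t"
proof -
  let ?g = "gaussian_binomial q"
  have n: "u \<le> n" "t \<le> n" "x \<le> n" using assms by auto
  have "x * (t - x + 1) + 3 \<le> x * (n - u)"
  proof -
    have "(t - x + 1) + (d - x) \<le> n - u" using assms by simp
    then have "x * ((t - x + 1) + (d - x)) \<le> x * (n - u)" by (rule mult_le_mono2)
    moreover have "3 \<le> x * (d - x)"
    proof -
      have "2 \<le> d - x" "4 \<le> d" using assms by auto
      then show ?thesis using mult_le_mono[of 2 x 2 "d - x"] assms(5) by (cases "x = 1") auto
    qed
    ultimately show ?thesis unfolding distrib_left[of x "t - x + 1"] by linarith
  qed
  then have "real q ^ (x * (t - x + 1)) * real q ^ 3 \<le> real q ^ (x * (n - u))"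
    unfolding power_add[symmetric] using assms by (intro power_increasing) auto
  moreover have "(2::real) ^ 3 \<le> real q ^ 3" using assms by (intro power_mono) auto
  then have "8 * real q ^ (x * (t - x + 1)) \<le> real q ^ (x * (t - x + 1)) * real q ^ 3"
    using mult_left_mono[of 8 "real q ^ 3" "real q ^ (x * (t - x + 1))"] by (simp add: mult.commute)
  ultimately have w: "8 * ?g t x \<le> real q ^ (x * (n - u))"
    using gaussian_binomial_le_power[OF assms(1,6)] by linarith
  have pos: "?g n x > 0" "?g u x \<ge> 0" "?g (n - x) (t - x) \<ge> 0" "?g n t \<ge> 0"
    using gaussian_binomial_pos[OF assms(1) n(3)] gaussian_binomial_nonneg[OF assms(1)] by auto
  have "?g n x * (8 * (?g u x * ?g (n - x) (t - x))) = ?g u x * (8 * (?g n t * ?g t x))"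
    using gaussian_binomial_subset_of_subset[OF assms(1,6) n(2)] by (simp add: mult_ac)
  also have "\<dots> \<le> ?g u x * (?g n t * real q ^ (x * (n - u)))"
    using pos w by (intro mult_left_mono) (auto simp: mult.left_commute[of 8] intro!: mult_left_mono)
  also have "\<dots> = (?g u x * real q ^ (x * (n - u))) * ?g n t" by simp
  also have "\<dots> \<le> ?g n x * ?g n t"
    using gaussian_binomial_mono_gap[OF assms(1) n(1) assms(7)] pos by (intro mult_right_mono) auto
  finally show ?thesis using pos(1) by simp
qed

section \<open>Levels of a family of bounded diameter\<close>

lemma vec_dim_le: "vec.dim (A :: ('a::field ^ 'n) set) \<le> CARD('n)"
  using vec.dim_subset_UNIV[of A] by (simp add: card_cart_basis vec.dimension_def)

lemma diam_le_subspace: "diam_le d F \<Longrightarrow> A \<in> F \<Longrightarrow> vec.subspace A"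
  by (simp add: diam_le_def)

lemma diam_leD:
  "diam_le d F \<Longrightarrow> A \<in> F \<Longrightarrow> B \<in> F \<Longrightarrow> vec.dim A + vec.dim B \<le> d + 2 * vec.dim (A \<inter> B)"
  by (simp add: diam_le_def)

lemma dim_Int_le:
  fixes A B :: "('a::field ^ 'n) set"
  shows "vec.dim (A \<inter> B) \<le> vec.dim A" "vec.dim (A \<inter> B) \<le> vec.dim B"
  by (auto intro: vec.dim_subset)

lemma diam_le_dim:
  assumes "diam_le d F" "A \<in> F" "B \<in> F"
  shows "vec.dim A \<le> vec.dim B + d"
  using diam_leD[OF assms] dim_Int_le[of A B] by simp

lemma subset_of_dim_Int:
  fixes A B :: "('a::{field,finite} ^ 'n) set"
  assumes "vec.subspace A" "vec.subspace B" "vec.dim A \<le> vec.dim (A \<inter> B)"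
  shows "A \<subseteq> B"
  using vec.subspace_dim_equal[of "A \<inter> B" A] assms vec.subspace_inter by blast

lemma card_family_levels:
  fixes F :: "('a::{field,finite} ^ 'n) set set"
  shows "card F = (\<Sum>k\<le>CARD('n). card (level F k))"
proof -
  have "F = (\<Union>k\<le>CARD('n). level F k)" using vec_dim_le by (auto simp: level_def)
  then have "card F = card (\<Union>k\<le>CARD('n). level F k)" by simp
  also have "\<dots> = (\<Sum>k\<le>CARD('n). card (level F k))"
    by (rule card_UN_disjoint) (auto simp: level_def)
  finally show ?thesis .
qed

lemma card_level_le_all:
  fixes F :: "('a::{field,finite} ^ 'n) set set"
  assumes "diam_le d F"
  shows "real (card (level F k)) \<le> gaussian_binomial CARD('a) CARD('n) k"
proof -
  have "card (level F k) \<le> card {A :: ('a ^ 'n) set. vec.subspace A \<and> vec.dim A = k}"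
    using assms by (intro card_mono) (auto simp: level_def diam_le_def)
  then show ?thesis by (simp flip: card_subspaces_dim)
qed

lemma card_perp_family:
  assumes "diam_le d F"
  shows "card (perp ` F) = card F"
  by (rule card_image, rule inj_on_subset[OF inj_on_perp]) (use assms in \<open>auto simp: diam_le_def\<close>)

lemma card_level_perp_family:
  fixes F :: "('a::{field,finite} ^ 'n) set set"
  assumes "diam_le d F" "k \<le> CARD('n)"
  shows "card (level (perp ` F) k) = card (level F (CARD('n) - k))"
  using card_level_perp assms by (auto simp: diam_le_def)

lemma card_superspaces:
  fixes X :: "('a::{field,finite} ^ 'n) set"
  assumes "vec.subspace X" "vec.dim X \<le> k"
  shows "real (card (subspaces_between X UNIV k)) = gaussian_binomial CARD('a) (CARD('n) - vec.dim X) (k - vec.dim X)"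
  using card_subspaces_between[of X UNIV "k - vec.dim X"] assms
  by (simp add: vec_dim_UNIV del: vec.dim_UNIV)

lemma card_subspaces_of:
  fixes U :: "('a::{field,finite} ^ 'n) set"
  assumes "vec.subspace U"
  shows "real (card (subspaces_between {0} U k)) = gaussian_binomial CARD('a) (vec.dim U) k"
  using card_subspaces_between[of "{0}" U k] assms by (simp add: vec.subspace_0)

text \<open>
  Under \<open>perp\<close> the hyperplanes of \<open>U\<close> correspond to the subspaces that contain \<open>perp U\<close> with
  codimension one.
\<close>

lemma card_hyperplanes:
  fixes U :: "('a::{field,finite} ^ 'n) set"
  assumes "vec.subspace U" "vec.dim U = Suc k"
  shows "real (card (subspaces_between {0} U k)) = gaussian_binomial CARD('a) (Suc k) 1"
proof -
  have d: "vec.dim (perp U) = CARD('n) - Suc k" "Suc k \<le> CARD('n)"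
    using dim_perp[OF assms(1)] assms(2) by simp_all
  have "perp ` subspaces_between {0} U k = subspaces_between (perp U) UNIV (CARD('n) - k)"
  proof (intro subset_antisym subsetI)
    fix B assume "B \<in> perp ` subspaces_between {0} U k"
    then obtain A where A: "B = perp A" "vec.subspace A" "A \<subseteq> U" "vec.dim A = k"
      by (auto simp: subspaces_between_def)
    then show "B \<in> subspaces_between (perp U) UNIV (CARD('n) - k)"
      using dim_perp[of A] perp_antimono[of A U] by (auto simp: subspaces_between_def)
  next
    fix B assume B: "B \<in> subspaces_between (perp U) UNIV (CARD('n) - k)"
    then have "perp B \<subseteq> perp (perp U)" by (intro perp_antimono) (auto simp: subspaces_between_def)
    then have "perp B \<in> subspaces_between {0} U k"
      using B assms dim_perp[of B] d by (auto simp: subspaces_between_def vec.subspace_0)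
    moreover have "B = perp (perp B)" using B by (simp add: subspaces_between_def)
    ultimately show "B \<in> perp ` subspaces_between {0} U k" by (rule rev_image_eqI)
  qed
  moreover have "inj_on perp (subspaces_between {0} U k)"
    by (rule inj_on_subset[OF inj_on_perp]) (auto simp: subspaces_between_def)
  ultimately have "card (subspaces_between {0} U k) = card (subspaces_between (perp U) UNIV (CARD('n) - k))"
    by (metis card_image)
  then show ?thesis using card_superspaces[of "perp U" "CARD('n) - k"] d
    by (simp add: Suc_diff_le diff_diff_eq2)
qed

lemma card_level_le_superspaces:
  fixes X :: "('a::{field,finite} ^ 'n) set"
  assumes "diam_le d F" "vec.subspace X" "vec.dim X \<le> k" "\<And>A. A \<in> level F k \<Longrightarrow> X \<subseteq> A"
  shows "real (card (level F k)) \<le> gaussian_binomial CARD('a) (CARD('n) - vec.dim X) (k - vec.dim X)"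
proof -
  have "level F k \<subseteq> subspaces_between X UNIV k"
    using assms by (auto simp: level_def subspaces_between_def diam_le_def)
  then have "card (level F k) \<le> card (subspaces_between X UNIV k)" by (intro card_mono) auto
  then show ?thesis by (simp flip: card_superspaces[OF assms(2,3)])
qed

lemma card_level_le_hyperplanes:
  fixes U :: "('a::{field,finite} ^ 'n) set"
  assumes "diam_le d F" "vec.subspace U" "vec.dim U = Suc k" "\<And>A. A \<in> level F k \<Longrightarrow> A \<subseteq> U"
  shows "real (card (level F k)) \<le> gaussian_binomial CARD('a) (Suc k) 1"
proof -
  have "level F k \<subseteq> subspaces_between {0} U k"
    using assms by (auto simp: level_def subspaces_between_def diam_le_def vec.subspace_0)
  then have "card (level F k) \<le> card (subspaces_between {0} U k)" by (intro card_mono) auto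
  then have "real (card (level F k)) \<le> real (card (subspaces_between {0} U k))" by simp
  then show ?thesis by (simp only: card_hyperplanes[OF assms(2,3)])
qed

lemma card_level_le_meeting:
  fixes U :: "('a::{field,finite} ^ 'n) set"
  assumes "diam_le d F" "vec.subspace U" "x \<le> k" "\<And>A. A \<in> level F k \<Longrightarrow> x \<le> vec.dim (A \<inter> U)"
  shows "real (card (level F k)) \<le>
    gaussian_binomial CARD('a) (vec.dim U) x * gaussian_binomial CARD('a) (CARD('n) - x) (k - x)"
proof -
  let ?Z = "subspaces_between {0} U x"
  have "level F k \<subseteq> (\<Union>Z\<in>?Z. subspaces_between Z UNIV k)"
  proof
    fix A assume A: "A \<in> level F k"
    then have s: "vec.subspace A" "vec.dim A = k" using assms(1) by (auto simp: level_def diam_le_def)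
    have "vec.subspace (A \<inter> U)" using s assms vec.subspace_inter by blast
    then obtain B where B: "vec.independent B" "vec.span B = A \<inter> U" "card B = vec.dim (A \<inter> U)" "finite B"
      using vec.basis_subspace_exists by metis
    then obtain B' where B': "B' \<subseteq> B" "card B' = x"
      using obtain_subset_with_card_n[of x B] assms(4)[OF A] by auto
    then have "vec.dim (vec.span B') = x"
      using vec.dim_span_eq_card_independent[of B'] vec.independent_mono[OF B(1)] by auto
    moreover have "vec.span B' \<subseteq> A \<inter> U" using vec.span_mono[OF B'(1)] B by auto
    ultimately show "A \<in> (\<Union>Z\<in>?Z. subspaces_between Z UNIV k)"
      using s by (intro UN_I[of "vec.span B'"]) (auto simp: subspaces_between_def vec.subspace_0)
  qed
  then have "card (level F k) \<le> card (\<Union>Z\<in>?Z. subspaces_between Z UNIV k)" by (intro card_mono) auto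
  also have "\<dots> \<le> (\<Sum>Z\<in>?Z. card (subspaces_between Z UNIV k))" by (rule card_UN_le) auto
  finally have "real (card (level F k)) \<le> (\<Sum>Z\<in>?Z. real (card (subspaces_between Z UNIV k)))"
    by (simp flip: of_nat_sum)
  also have "\<dots> = (\<Sum>Z\<in>?Z. gaussian_binomial CARD('a) (CARD('n) - x) (k - x))"
    using card_superspaces assms(3) by (intro sum.cong) (auto simp: subspaces_between_def)
  finally show ?thesis by (simp add: card_subspaces_of[OF assms(2)])
qed

text \<open>
  Two distinct members of the code meet in dimension less than \<open>k - d div 2\<close>, hence they violate
  the distance bound.
\<close>

lemma card_level_le_rank_metric:
  fixes F :: "('a::{field,finite} ^ 'n) set set"
  assumes "diam_le d F" "d div 2 < k" "2 * k \<le> CARD('n)"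
  shows "real CARD('a) ^ ((CARD('n) - k) * (k - d div 2)) * real (card (level F k))
    \<le> gaussian_binomial CARD('a) CARD('n) k"
proof -
  let ?r = "k - d div 2"
  obtain C :: "('a ^ 'n) set set" and W where C: "card C = CARD('a) ^ ((CARD('n) - k) * ?r)"
    "\<And>X. X \<in> C \<Longrightarrow> vec.subspace X \<and> vec.dim X = k"
    "\<And>X Y. X \<in> C \<Longrightarrow> Y \<in> C \<Longrightarrow> X \<noteq> Y \<Longrightarrow> vec.dim (X \<inter> Y) < ?r"
    by (rule rank_metric_code_exists[of k "CARD('n) - k" ?r, where 'a='a and 'n='n])
      (use assms in auto)
  have "real (card C) * real (card (level F k)) \<le> gaussian_binomial CARD('a) CARD('n) k"
  proof (rule card_level_le_code[OF assms(1) _ C(2)])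
    fix X Y assume "X \<in> C" "Y \<in> C" "X \<noteq> Y"
    then have "vec.dim (X \<inter> Y) < ?r" by (rule C(3))
    then show "d + 2 * vec.dim (X \<inter> Y) < 2 * k" by linarith
  qed (use assms in auto)
  then show ?thesis by (simp add: C(1))
qed

text \<open>
  In a space of twice the dimension \<open>k = t + 1\<close>, the code with \<open>q ^ k\<close> elements and its vertical
  subspace form a spread of \<open>q ^ k + 1\<close> subspaces, and \<open>[n, k] = (q ^ k + 1) * [n - 1, t]\<close>.
\<close>

lemma card_middle_level:
  fixes F :: "('a::{field,finite} ^ 'n) set set"
  assumes "diam_le (2 * t + 1) F" "CARD('n) = 2 * t + 2"
  shows "real (card (level F (t + 1))) \<le> gaussian_binomial CARD('a) (CARD('n) - 1) t"
proof -
  let ?q = "CARD('a)" and ?k = "t + 1"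
  obtain C :: "('a ^ 'n) set set" and W where C: "card C = ?q ^ (?k * 1)"
    "\<And>X. X \<in> C \<Longrightarrow> vec.subspace X \<and> vec.dim X = ?k"
    "\<And>X Y. X \<in> C \<Longrightarrow> Y \<in> C \<Longrightarrow> X \<noteq> Y \<Longrightarrow> vec.dim (X \<inter> Y) < 1"
    "vec.subspace W" "vec.dim W = ?k" "\<And>X. X \<in> C \<Longrightarrow> vec.dim (X \<inter> W) = 0"
    by (rule rank_metric_code_exists[of ?k ?k 1, where 'a='a and 'n='n]) (use assms(2) in auto)
  have "W \<notin> C" using C(5) C(6)[of W] by auto
  then have card: "card (insert W C) = ?q ^ ?k + 1" using C(1) by simp
  have "real (card (insert W C)) * real (card (level F ?k)) \<le> gaussian_binomial ?q CARD('n) ?k"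
  proof (rule card_level_le_code[OF assms(1)])
    fix X Y assume XY: "X \<in> insert W C" "Y \<in> insert W C" "X \<noteq> Y"
    have "vec.dim (X \<inter> Y) = 0"
    proof (cases "X = W \<or> Y = W")
      case True
      then show ?thesis using XY C(6) by (metis Int_commute insert_iff)
    next
      case False
      then show ?thesis using XY C(3)[of X Y] by simp
    qed
    then show "2 * t + 1 + 2 * vec.dim (X \<inter> Y) < 2 * ?k" by simp
  qed (use C assms(2) in auto)
  also have "gaussian_binomial ?q CARD('n) ?k =
      (real ?q ^ CARD('n) - 1) / (real ?q ^ ?k - 1) * gaussian_binomial ?q (CARD('n) - 1) t"
    using gaussian_binomial_Suc_Suc[of ?q "CARD('n) - 1" t] assms(2) by simp
  also have "(real ?q ^ CARD('n) - 1) / (real ?q ^ ?k - 1) = real ?q ^ ?k + 1"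
  proof -
    have "real ?q ^ ?k > 1" using card_field_ge2[where 'a='a] by (intro one_less_power) auto
    moreover have "real ?q ^ CARD('n) = real ?q ^ ?k * real ?q ^ ?k"
      unfolding assms(2) by (simp flip: power_add add: mult_2)
    ultimately show ?thesis by (simp add: divide_eq_eq algebra_simps)
  qed
  finally have "(real ?q ^ ?k + 1) * real (card (level F ?k)) \<le> (real ?q ^ ?k + 1) * gaussian_binomial ?q (CARD('n) - 1) t"
    using card by (simp add: add.commute)
  moreover have "real ?q ^ ?k + 1 > 0" by (simp add: add_pos_nonneg)
  ultimately show ?thesis by simp
qed

text \<open>
  If the members of the level share a point, the bound is the number of subspaces through that
  point. Otherwise every member contains a point \<open>P\<close> of a fixed member \<open>U\<close>, and for each such
  \<open>P\<close> there is a member \<open>C\<close> that avoids it, so that a member through \<open>P\<close> contains a line that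
  joins \<open>P\<close> to a point of \<open>C\<close>. This leaves at most \<open>[t + 1, 1] ^ 2 * [n - 2, t - 1]\<close> members,
  which is at most \<open>[n - 1, t]\<close> in the given range of dimensions.
\<close>

lemma card_level_intersecting:
  fixes F :: "('a::{field,finite} ^ 'n) set set"
  assumes "diam_le (2 * t + 1) F" "CARD('n) \<ge> 4 * t + 3" "t \<ge> 1"
  shows "real (card (level F (t + 1))) \<le> gaussian_binomial CARD('a) (CARD('n) - 1) t"
proof (cases "\<exists>P. vec.subspace P \<and> vec.dim P = 1 \<and> (\<forall>A\<in>level F (t + 1). P \<subseteq> A)")
  case True
  then obtain P where P: "vec.subspace P" "vec.dim P = 1" "\<forall>A\<in>level F (t + 1). P \<subseteq> A" by auto
  then show ?thesis using card_level_le_superspaces[OF assms(1) P(1), of "t + 1"] by simp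
next
  case False
  let ?q = "CARD('a)" and ?n = "CARD('n)" and ?L = "level F (t + 1)"
  let ?g = "gaussian_binomial ?q"
  have q: "?q \<ge> 2" by (rule card_field_ge2)
  have nn: "?g m k \<ge> 0" for m k by (rule gaussian_binomial_nonneg[OF q])
  have L: "vec.subspace A" "vec.dim A = t + 1" if "A \<in> ?L" for A
    using that assms(1) by (auto simp: level_def diam_le_def)
  have meet: "vec.dim (A \<inter> B) \<ge> 1" if "A \<in> ?L" "B \<in> ?L" for A B
    using that diam_leD[OF assms(1), of A B] by (auto simp: level_def)
  show ?thesis
  proof (cases "?L = {}")
    case True
    then show ?thesis using nn by simp
  next
    case ne: False
    then obtain U where U: "U \<in> ?L" by auto
    let ?P = "subspaces_between {0} U 1"
    have cover: "?L \<subseteq> (\<Union>P\<in>?P. {A \<in> ?L. P \<subseteq> A})"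
    proof
      fix A assume A: "A \<in> ?L"
      then obtain v where v: "v \<in> A \<inter> U" "v \<noteq> 0"
        using meet[OF A U] vec.dim_eq_0[of "A \<inter> U"] by fastforce
      have "vec.dim (vec.span {v}) = 1" using v by simp
      moreover have "vec.span {v} \<subseteq> A" "vec.span {v} \<subseteq> U"
        using v L[OF A] L[OF U] vec.span_minimal[of "{v}" A] vec.span_minimal[of "{v}" U] by simp_all
      ultimately show "A \<in> (\<Union>P\<in>?P. {A \<in> ?L. P \<subseteq> A})"
        using A by (intro UN_I[of "vec.span {v}"]) (auto simp: subspaces_between_def vec.subspace_0)
    qed
    have fib: "real (card {A \<in> ?L. P \<subseteq> A}) \<le> ?g (t + 1) 1 * ?g (?n - 2) (t - 1)" if P: "P \<in> ?P" for P
    proof -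
      have P': "vec.subspace P" "vec.dim P = 1" using P by (auto simp: subspaces_between_def)
      then obtain C where C: "C \<in> ?L" "\<not> P \<subseteq> C" using False by blast
      let ?R = "subspaces_between {0} C 1"
      have "{A \<in> ?L. P \<subseteq> A} \<subseteq> (\<Union>R\<in>?R. subspaces_between (vec.span (P \<union> R)) UNIV (t + 1))"
      proof
        fix A assume A: "A \<in> {A \<in> ?L. P \<subseteq> A}"
        then obtain v where v: "v \<in> A \<inter> C" "v \<noteq> 0"
          using meet[of A C] C vec.dim_eq_0[of "A \<inter> C"] by fastforce
        have "vec.dim (vec.span {v}) = 1" using v by simp
        moreover have "vec.span {v} \<subseteq> A" "vec.span {v} \<subseteq> C"
          using v A L[of A] L[of C] C vec.span_minimal[of "{v}" A] vec.span_minimal[of "{v}" C] by simp_all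
        moreover from this have "vec.span (P \<union> vec.span {v}) \<subseteq> A"
          using A L[of A] by (intro vec.span_minimal) auto
        ultimately show "A \<in> (\<Union>R\<in>?R. subspaces_between (vec.span (P \<union> R)) UNIV (t + 1))"
          using A L[of A] by (intro UN_I[of "vec.span {v}"]) (auto simp: subspaces_between_def vec.subspace_0)
      qed
      then have "card {A \<in> ?L. P \<subseteq> A} \<le> card (\<Union>R\<in>?R. subspaces_between (vec.span (P \<union> R)) UNIV (t + 1))"
        by (intro card_mono) auto
      also have "\<dots> \<le> (\<Sum>R\<in>?R. card (subspaces_between (vec.span (P \<union> R)) UNIV (t + 1)))" by (rule card_UN_le) auto
      finally have "real (card {A \<in> ?L. P \<subseteq> A}) \<le> (\<Sum>R\<in>?R. real (card (subspaces_between (vec.span (P \<union> R)) UNIV (t + 1))))"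
        by (simp flip: of_nat_sum)
      also have "\<dots> = (\<Sum>R\<in>?R. ?g (?n - 2) (t - 1))"
      proof (rule sum.cong[OF refl])
        fix R assume R: "R \<in> ?R"
        then have R': "vec.subspace R" "vec.dim R = 1" "R \<subseteq> C" by (auto simp: subspaces_between_def)
        have "vec.dim (P \<inter> R) \<noteq> 1"
        proof
          assume "vec.dim (P \<inter> R) = 1"
          then have "P \<subseteq> R" using P' R' by (intro subset_of_dim_Int) auto
          then show False using C R' by blast
        qed
        moreover have "vec.dim (P \<inter> R) \<le> 1" using dim_Int_le(1)[of P R] P' by simp
        ultimately have "vec.dim (P \<inter> R) = 0" by linarith
        then have "vec.dim (vec.span (P \<union> R)) = 2" using dim_sum_span[OF P'(1) R'(1)] P' R' by linarith
        then show "real (card (subspaces_between (vec.span (P \<union> R)) UNIV (t + 1))) = ?g (?n - 2) (t - 1)"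
          using card_superspaces[of "vec.span (P \<union> R)" "t + 1"] assms(3) by (simp del: vec.dim_span)
      qed
      also have "\<dots> = ?g (t + 1) 1 * ?g (?n - 2) (t - 1)"
        using card_subspaces_of[of C 1] L[OF C(1)] by simp
      finally show ?thesis .
    qed
    have "card ?L \<le> card (\<Union>P\<in>?P. {A \<in> ?L. P \<subseteq> A})" using cover by (intro card_mono) auto
    also have "\<dots> \<le> (\<Sum>P\<in>?P. card {A \<in> ?L. P \<subseteq> A})" by (rule card_UN_le) auto
    finally have "real (card ?L) \<le> (\<Sum>P\<in>?P. real (card {A \<in> ?L. P \<subseteq> A}))" by (simp flip: of_nat_sum)
    also have "\<dots> \<le> (\<Sum>P\<in>?P. ?g (t + 1) 1 * ?g (?n - 2) (t - 1))" by (intro sum_mono fib)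
    also have "\<dots> = (?g (t + 1) 1 * ?g (t + 1) 1) * ?g (?n - 2) (t - 1)"
      using card_subspaces_of[of U 1] L[OF U] by simp
    also have "\<dots> \<le> ((real ?q ^ (?n - 1) - 1) / (real ?q ^ t - 1)) * ?g (?n - 2) (t - 1)"
    proof (rule mult_right_mono[OF _ nn])
      let ?a = "real ?q ^ (t + 1)" and ?b = "real ?q ^ t"
      have b: "?b > 1" using q assms by (intro one_less_power) auto
      have a: "?a > 1" using q by (intro one_less_power) auto
      have g1: "?g (t + 1) 1 \<le> ?a - 1" "0 \<le> ?g (t + 1) 1"
        using q a nn unfolding gaussian_binomial_1 by (auto simp: divide_le_eq mult_le_cancel_left1)
      have "?g (t + 1) 1 * ?g (t + 1) 1 * (?b - 1) \<le> (?a - 1) * (?a - 1) * (?b - 1)"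
        using g1 b by (intro mult_right_mono mult_mono) auto
      also have "\<dots> \<le> ?a * ?a * ?b - 1"
      proof -
        have "(?a - 1) * (?a - 1) \<le> ?a * ?a - 1" using a by (simp add: algebra_simps)
        then have "(?a - 1) * (?a - 1) * (?b - 1) \<le> (?a * ?a - 1) * (?b - 1)" using b by (intro mult_right_mono) auto
        also have "\<dots> \<le> ?a * ?a * ?b - 1"
        proof -
          have "1 \<le> ?a * ?a" using a mult_mono[of 1 ?a 1 ?a] by simp
          then show ?thesis using b by (simp add: algebra_simps)
        qed
        finally show ?thesis .
      qed
      also have "?a * ?a * ?b = real ?q ^ (3 * t + 2)"
        unfolding power_add[symmetric] by (rule arg_cong[of _ _ "(^) (real ?q)"]) simp
      also have "\<dots> - 1 \<le> real ?q ^ (?n - 1) - 1"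
        using q assms by (intro diff_right_mono power_increasing) auto
      finally show "?g (t + 1) 1 * ?g (t + 1) 1 \<le> (real ?q ^ (?n - 1) - 1) / (?b - 1)"
        using b by (simp add: pos_le_divide_eq)
    qed
    also have "\<dots> = ?g (?n - 1) t"
      using gaussian_binomial_Suc_Suc[of ?q "?n - 2" "t - 1"] assms by (simp add: Suc_diff_Suc numeral_2_eq_2)
    finally show ?thesis .
  qed
qed

section \<open>Ambient dimension one above the diameter\<close>

text \<open>
  For \<open>k \<le> t\<close> the levels \<open>k\<close> and \<open>n - k\<close> have at most \<open>[n, k]\<close> members together. These pairs
  exhaust all levels, except that the level \<open>t + 1\<close> is its own partner when \<open>d\<close> is odd.
\<close>

lemma card_le_ambient_Suc:
  fixes F :: "('a::{field,finite} ^ 'n) set set"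
  assumes "diam_le d F" "CARD('n) = d + 1"
  shows "d = 2 * t \<Longrightarrow> real (card F) \<le> (\<Sum>i\<le>t. gaussian_binomial CARD('a) CARD('n) i)"
    and "d = 2 * t + 1 \<Longrightarrow> real (card F) \<le>
      (\<Sum>i\<le>t. gaussian_binomial CARD('a) CARD('n) i) + gaussian_binomial CARD('a) (CARD('n) - 1) t"
proof -
  let ?n = "CARD('n)" and ?f = "\<lambda>k. real (card (level F k))"
  let ?g = "gaussian_binomial CARD('a) ?n"
  have pair: "?f k + ?f (?n - k) \<le> ?g k" if "2 * k < ?n" for k
    by (rule card_complementary_levels[OF assms]) (use that in auto)
  have low: "(\<Sum>k\<le>t. ?f k + ?f (?n - k)) \<le> (\<Sum>i\<le>t. ?g i)" if "2 * t < ?n"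
    using that by (intro sum_mono pair) auto
  have mirror: "(\<Sum>k\<le>t. ?f (?n - k)) = (\<Sum>k\<in>{?n - t..?n}. ?f k)" if "t \<le> ?n"
    by (rule sum.reindex_bij_witness[of _ "\<lambda>k. ?n - k" "\<lambda>k. ?n - k"]) (use that in auto)
  have total: "real (card F) = (\<Sum>k\<le>?n. ?f k)"
    using arg_cong[OF card_family_levels[of F], of real] by (simp only: of_nat_sum)
  show "real (card F) \<le> (\<Sum>i\<le>t. ?g i)" if d: "d = 2 * t"
  proof -
    have "{..?n} = {..t} \<union> {?n - t..?n}" using assms d by auto
    then have "real (card F) = (\<Sum>k\<le>t. ?f k) + (\<Sum>k\<in>{?n - t..?n}. ?f k)"
      unfolding total using assms d by (subst sum.union_disjoint[symmetric]) auto
    then show ?thesis using low mirror assms d by (simp add: sum.distrib)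
  qed
  show "real (card F) \<le> (\<Sum>i\<le>t. ?g i) + gaussian_binomial CARD('a) (?n - 1) t" if d: "d = 2 * t + 1"
  proof -
    have "{..?n} = insert (t + 1) ({..t} \<union> {?n - t..?n})" using assms d by auto
    then have "real (card F) = ?f (t + 1) + (\<Sum>k\<in>{..t} \<union> {?n - t..?n}. ?f k)"
      unfolding total using assms d by (subst sum.insert[symmetric]) auto
    also have "(\<Sum>k\<in>{..t} \<union> {?n - t..?n}. ?f k) = (\<Sum>k\<le>t. ?f k) + (\<Sum>k\<in>{?n - t..?n}. ?f k)"
      using assms d by (intro sum.union_disjoint) auto
    finally show ?thesis
      using low mirror assms d card_middle_level[of t F] by (simp add: sum.distrib)
  qed
qed

section \<open>Families away from both ends: diameter at least 4\<close>

text \<open>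
  Up to the middle dimension this is the rank metric bound; above it, the bound for the dual
  family.
\<close>

lemma card_central_level:
  fixes F :: "('a::{field,finite} ^ 'n) set set"
  assumes "diam_le d F" "t = d div 2" "t \<ge> 2" "t < k" "k + t < CARD('n)"
  shows "real (card (level F k)) \<le> (2/7) ^ (min k (CARD('n) - k) - t) * gaussian_binomial CARD('a) CARD('n) t"
proof -
  have *: "real (card (level H j)) \<le> (2/7) ^ (j - t) * gaussian_binomial CARD('a) CARD('n) t"
    if H: "diam_le d H" "t < j" "2 * j \<le> CARD('n)" for H :: "('a ^ 'n) set set" and j
  proof -
    let ?Q = "real CARD('a) ^ ((CARD('n) - j) * (j - t))"
    have "?Q * real (card (level H j)) \<le> gaussian_binomial CARD('a) CARD('n) j"
      using card_level_le_rank_metric[OF H(1), of j] H assms(2) by simp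
    also have "\<dots> \<le> (2/7) ^ (j - t) * gaussian_binomial CARD('a) CARD('n) t * ?Q"
      using gaussian_binomial_le_geometric[OF card_field_ge2[where 'a='a] assms(3), of "j - t" "CARD('n)"] H by simp
    finally have "?Q * real (card (level H j)) \<le> ?Q * ((2/7) ^ (j - t) * gaussian_binomial CARD('a) CARD('n) t)"
      by (simp add: mult.commute)
    moreover have "?Q > 0" using card_field_ge2[where 'a='a] by simp
    ultimately show ?thesis by simp
  qed
  show ?thesis
  proof (cases "2 * k \<le> CARD('n)")
    case True
    then show ?thesis using *[OF assms(1,4)] by (simp add: min_def)
  next
    case False
    then show ?thesis
      using *[OF diam_le_perp[OF assms(1)], of "CARD('n) - k"] card_level_perp_family[OF assms(1), of "CARD('n) - k"] assms
      by (simp add: min_def)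
  qed
qed

lemma sum_two_sevenths_le: "(\<Sum>j\<in>{1..m}. (2/7::real) ^ j) \<le> 2/5"
proof -
  have "(\<Sum>j\<in>{1..m}. (2/7::real) ^ j) = 2/5 * (1 - (2/7) ^ m)"
    by (induction m) (simp_all add: algebra_simps)
  then show ?thesis by simp
qed

lemma sum_central_levels:
  fixes F :: "('a::{field,finite} ^ 'n) set set"
  assumes "diam_le d F" "t = d div 2" "t \<ge> 2" "2 * t < CARD('n)"
  shows "(\<Sum>k\<in>{t<..<CARD('n) - t}. real (card (level F k))) \<le> 4/5 * gaussian_binomial CARD('a) CARD('n) t"
proof -
  let ?n = "CARD('n)" and ?G = "gaussian_binomial CARD('a) CARD('n) t"
  let ?I = "{t<..<?n - t}"
  have G: "?G \<ge> 0" by (rule gaussian_binomial_nonneg[OF card_field_ge2])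
  have "(\<Sum>k\<in>?I. real (card (level F k))) \<le> (\<Sum>k\<in>?I. ((2/7) ^ (k - t) + (2/7) ^ (?n - k - t)) * ?G)"
  proof (rule sum_mono)
    fix k assume k: "k \<in> ?I"
    have "real (card (level F k)) \<le> (2/7) ^ (min k (?n - k) - t) * ?G"
      using k by (intro card_central_level[OF assms(1-3)]) auto
    also have "(2/7::real) ^ (min k (?n - k) - t) \<le> (2/7) ^ (k - t) + (2/7) ^ (?n - k - t)"
      by (simp add: min_def)
    then have "(2/7) ^ (min k (?n - k) - t) * ?G \<le> ((2/7) ^ (k - t) + (2/7) ^ (?n - k - t)) * ?G"
      using G by (intro mult_right_mono)
    finally show "real (card (level F k)) \<le> ((2/7) ^ (k - t) + (2/7) ^ (?n - k - t)) * ?G" .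
  qed
  also have "\<dots> = ((\<Sum>k\<in>?I. (2/7) ^ (k - t)) + (\<Sum>k\<in>?I. (2/7) ^ (?n - k - t))) * ?G"
    by (simp add: sum.distrib flip: sum_distrib_right)
  also have "(\<Sum>k\<in>?I. (2/7::real) ^ (k - t)) = (\<Sum>j\<in>{1..?n - 2 * t - 1}. (2/7) ^ j)"
    by (rule sum.reindex_bij_witness[of _ "\<lambda>j. j + t" "\<lambda>k. k - t"]) (use assms(4) in auto)
  also have "(\<Sum>k\<in>?I. (2/7::real) ^ (?n - k - t)) = (\<Sum>j\<in>{1..?n - 2 * t - 1}. (2/7) ^ j)"
    by (rule sum.reindex_bij_witness[of _ "\<lambda>j. ?n - t - j" "\<lambda>k. ?n - k - t"]) (use assms(4) in auto)
  finally show ?thesis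
    using mult_right_mono[OF sum_two_sevenths_le[of "?n - 2 * t - 1"] G] by (simp add: algebra_simps)
qed

text \<open>
  The distance to \<open>U\<close> forces each member of dimension \<open>t\<close> to meet \<open>U\<close> in dimension at least
  \<open>(t + dim U - d) / 2 > 0\<close>; the integer \<open>x\<close> in the proof is this number rounded up.
\<close>

lemma card_level_half_diam:
  fixes F :: "('a::{field,finite} ^ 'n) set set"
  assumes "diam_le d F" "t = d div 2" "t \<ge> 2" "2 * d < CARD('n)" "U \<in> F" "d < vec.dim U + t"
  shows "8 * real (card (level F t)) \<le> gaussian_binomial CARD('a) CARD('n) t"
proof (cases "level F t = {}")
  case True
  then show ?thesis using gaussian_binomial_nonneg[OF card_field_ge2[where 'a='a]] by simp
next
  case False
  then obtain A where A: "A \<in> F" "vec.dim A = t" by (auto simp: level_def)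
  let ?u = "vec.dim U"
  define x where "x = (t + ?u - d + 1) div 2"
  have u: "?u \<le> t + d" using diam_le_dim[OF assms(1,5) A(1)] A by simp
  have x: "1 \<le> x" "x \<le> t" "x \<le> ?u" "?u + t \<le> d + 2 * x"
    using assms u by (auto simp: x_def)
  have "x \<le> vec.dim (B \<inter> U)" if "B \<in> level F t" for B
    using diam_leD[OF assms(1), of B U] that assms(5) by (auto simp: x_def level_def)
  then have "real (card (level F t)) \<le> gaussian_binomial CARD('a) ?u x * gaussian_binomial CARD('a) (CARD('n) - x) (t - x)"
    by (intro card_level_le_meeting[OF assms(1) diam_le_subspace[OF assms(1,5)] x(2)])
  moreover have "8 * (gaussian_binomial CARD('a) ?u x * gaussian_binomial CARD('a) (CARD('n) - x) (t - x))
      \<le> gaussian_binomial CARD('a) CARD('n) t"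
    by (rule gaussian_binomial_meeting_le[OF card_field_ge2 assms(3)]) (use assms x in auto)
  ultimately show ?thesis by linarith
qed

text \<open>
  The levels below \<open>t\<close> are bounded trivially. The level \<open>t\<close> and the levels above it take up at
  most \<open>1 / 8 + 4 / 5 < 1\<close> of \<open>[n, t]\<close>.
\<close>

lemma card_le_off_ends_large_diam:
  fixes F :: "('a::{field,finite} ^ 'n) set set"
  assumes "diam_le d F" "t = d div 2" "t \<ge> 2" "2 * d < CARD('n)" "U \<in> F" "d < vec.dim U + t"
    and high: "\<And>A. A \<in> F \<Longrightarrow> vec.dim A + t < CARD('n)"
  shows "real (card F) \<le> (\<Sum>i\<le>t. gaussian_binomial CARD('a) CARD('n) i)"
proof -
  let ?n = "CARD('n)" and ?f = "\<lambda>k. real (card (level F k))"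
  let ?g = "gaussian_binomial CARD('a) ?n"
  have n: "2 * t < ?n" using assms by simp
  have z: "?f k = 0" if "k \<in> {?n - t..?n}" for k
    using high that by (force simp: level_def)
  have "{..?n} = insert t ({..<t} \<union> ({t<..<?n - t} \<union> {?n - t..?n}))" using n by auto
  then have "real (card F) = (\<Sum>k\<in>insert t ({..<t} \<union> ({t<..<?n - t} \<union> {?n - t..?n})). ?f k)"
    using arg_cong[OF card_family_levels[of F], of real] by (simp only: of_nat_sum)
  also have "\<dots> = ?f t + (\<Sum>k\<in>{..<t} \<union> ({t<..<?n - t} \<union> {?n - t..?n}). ?f k)"
    using n by (subst sum.insert) auto
  also have "(\<Sum>k\<in>{..<t} \<union> ({t<..<?n - t} \<union> {?n - t..?n}). ?f k) =
      (\<Sum>k<t. ?f k) + ((\<Sum>k\<in>{t<..<?n - t}. ?f k) + (\<Sum>k\<in>{?n - t..?n}. ?f k))"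
    using n by (subst sum.union_disjoint, auto)+
  also have "(\<Sum>k\<in>{?n - t..?n}. ?f k) = 0" using z by (intro sum.neutral) auto
  finally have "real (card F) = ?f t + (\<Sum>k<t. ?f k) + (\<Sum>k\<in>{t<..<?n - t}. ?f k)" by simp
  moreover have "(\<Sum>k<t. ?f k) \<le> (\<Sum>k<t. ?g k)" by (intro sum_mono card_level_le_all[OF assms(1)])
  moreover have "(\<Sum>i\<le>t. ?g i) = (\<Sum>i<t. ?g i) + ?g t" by (simp add: lessThan_Suc_atMost[symmetric])
  moreover have "?g t \<ge> 0" by (rule gaussian_binomial_nonneg[OF card_field_ge2])
  ultimately show ?thesis
    using card_level_half_diam[OF assms(1-6)] sum_central_levels[OF assms(1-3) n] by linarith
qed

section \<open>Families away from both ends: diameter 2 or 3\<close>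

text \<open>
  Any two distinct members of the level meet in dimension \<open>k - 1\<close>. A member that does not
  contain \<open>A \<inter> B\<close> is the sum of its intersections with \<open>A\<close> and \<open>B\<close> and so lies in \<open>A + B\<close>. If
  \<open>C\<close> is such a member and \<open>D\<close> is one outside \<open>A + B\<close>, then \<open>D\<close> meets \<open>A + B\<close> precisely in
  \<open>A \<inter> B\<close>; hence \<open>C \<inter> D\<close> is contained in \<open>A \<inter> B\<close>, equals it by dimension, and \<open>C\<close> contains
  \<open>A \<inter> B\<close> after all.
\<close>

lemma star_or_hyperplanes:
  fixes F :: "('a::{field,finite} ^ 'n) set set"
  assumes "diam_le d F" "d \<le> 3" "1 \<le> k"
    and A: "A \<in> level F k" and B: "B \<in> level F k" and "A \<noteq> B"
  shows "(\<forall>D\<in>level F k. A \<inter> B \<subseteq> D) \<or> (\<forall>D\<in>level F k. D \<subseteq> vec.span (A \<union> B))"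
    and "vec.dim (A \<inter> B) = k - 1" "vec.dim (vec.span (A \<union> B)) = k + 1"
proof -
  have L: "vec.subspace D" "vec.dim D = k" if "D \<in> level F k" for D
    using that assms(1) by (auto simp: level_def diam_le_def)
  have meet: "k \<le> vec.dim (D \<inter> E) + 1" if "D \<in> level F k" "E \<in> level F k" for D E
    using that diam_leD[OF assms(1), of D E] assms(2) by (auto simp: level_def)
  have meet': "vec.dim (D \<inter> E) = k - 1" if "D \<in> level F k" "E \<in> level F k" "D \<noteq> E" for D E
  proof -
    have "vec.dim (D \<inter> E) \<noteq> k"
    proof
      assume "vec.dim (D \<inter> E) = k"
      then have "D \<subseteq> E" "E \<subseteq> D"
        using that L subset_of_dim_Int[of D E] subset_of_dim_Int[of E D] by (simp_all add: Int_commute)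
      then show False using that by blast
    qed
    moreover have "vec.dim (D \<inter> E) \<le> k" using dim_Int_le(1)[of D E] L that by simp
    ultimately show ?thesis using meet[OF that(1,2)] by linarith
  qed
  let ?X = "A \<inter> B" and ?Y = "vec.span (A \<union> B)"
  show dX: "vec.dim ?X = k - 1" by (rule meet'[OF A B \<open>A \<noteq> B\<close>])
  show "vec.dim ?Y = k + 1"
    using dim_sum_span[OF L(1)[OF A] L(1)[OF B]] dX L A B assms(3) by (simp del: vec.dim_span)
  have sX: "vec.subspace ?X" using L A B vec.subspace_inter by blast
  have inY: "D \<subseteq> ?Y" if D: "D \<in> level F k" and nX: "\<not> ?X \<subseteq> D" for D
  proof -
    have ne: "D \<noteq> A" "D \<noteq> B" using nX by auto
    have sub: "vec.subspace (D \<inter> A)" "vec.subspace (D \<inter> B)" using L D A B vec.subspace_inter by blast+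
    have "vec.dim (D \<inter> A \<inter> (D \<inter> B)) \<noteq> k - 1"
    proof
      assume *: "vec.dim (D \<inter> A \<inter> (D \<inter> B)) = k - 1"
      have "D \<inter> A \<inter> (D \<inter> B) = ?X"
        by (rule vec.subspace_dim_equal) (use * dX sX sub vec.subspace_inter in auto)
      then show False using nX by blast
    qed
    moreover have "vec.dim (D \<inter> A \<inter> (D \<inter> B)) \<le> k - 1"
      using dim_Int_le(1)[of "D \<inter> A" "D \<inter> B"] meet'[OF D A ne(1)] by simp
    ultimately have "k \<le> vec.dim (vec.span ((D \<inter> A) \<union> (D \<inter> B)))"
      using dim_sum_span[OF sub] meet'[OF D A ne(1)] meet'[OF D B ne(2)] by linarith
    moreover have "vec.span ((D \<inter> A) \<union> (D \<inter> B)) \<subseteq> D" using L(1)[OF D] by (intro vec.span_minimal) auto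
    ultimately have "vec.span ((D \<inter> A) \<union> (D \<inter> B)) = D"
      using L[OF D] by (intro vec.subspace_dim_equal) auto
    moreover have "vec.span ((D \<inter> A) \<union> (D \<inter> B)) \<subseteq> ?Y" by (intro vec.span_mono) auto
    ultimately show ?thesis by simp
  qed
  show "(\<forall>D\<in>level F k. ?X \<subseteq> D) \<or> (\<forall>D\<in>level F k. D \<subseteq> ?Y)"
  proof (rule ccontr)
    assume "\<not> ?thesis"
    then obtain C D where C: "C \<in> level F k" "\<not> ?X \<subseteq> C" and D: "D \<in> level F k" "\<not> D \<subseteq> ?Y" by blast
    have XD: "?X \<subseteq> D" using inY[OF D(1)] D(2) by blast
    have CY: "C \<subseteq> ?Y" by (rule inY[OF C])
    have sDY: "vec.subspace (D \<inter> ?Y)" using L(1)[OF D(1)] vec.subspace_inter by blast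
    have "\<not> k \<le> vec.dim (D \<inter> ?Y)"
      using subset_of_dim_Int[OF L(1)[OF D(1)], of ?Y] L(2)[OF D(1)] D(2) by auto
    moreover have "?X \<subseteq> D \<inter> ?Y" using XD by (auto intro: vec.span_base)
    ultimately have X: "?X = D \<inter> ?Y"
      using dX by (intro vec.subspace_dim_equal[OF sX sDY]) auto
    have "C \<noteq> D" using C XD by blast
    then have "vec.dim (C \<inter> D) = k - 1" by (rule meet'[OF C(1) D(1)])
    moreover have "vec.subspace (C \<inter> D)" by (intro vec.subspace_inter L C(1) D(1))
    moreover have "C \<inter> D \<subseteq> ?X" using X CY by blast
    ultimately have "C \<inter> D = ?X"
      using dX sX by (intro vec.subspace_dim_equal) auto
    then show False using C(2) by blast
  qed
qed

lemma card_level_small_diam: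
  fixes F :: "('a::{field,finite} ^ 'n) set set"
  assumes "diam_le d F" "d \<le> 3" "1 \<le> k" "k < CARD('n)" "k + 1 \<le> m" "CARD('n) - k + 1 \<le> m"
  shows "real (card (level F k)) \<le> gaussian_binomial CARD('a) m 1"
proof -
  let ?p = "\<lambda>m. gaussian_binomial CARD('a) m 1"
  note mono = gaussian_binomial_mono[OF card_field_ge2[where 'a='a]]
  have p1: "1 \<le> ?p m"
    using mono[of 1 m] assms(5) card_field_ge2[where 'a='a] by (simp add: gaussian_binomial_1[unfolded One_nat_def])
  show ?thesis
  proof (cases "\<exists>A\<in>level F k. \<exists>B\<in>level F k. A \<noteq> B")
    case True
    then obtain A B where AB: "A \<in> level F k" "B \<in> level F k" "A \<noteq> B" by blast
    note s = star_or_hyperplanes[OF assms(1-3) AB]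
    have sub: "vec.subspace (A \<inter> B)"
      using AB assms(1) vec.subspace_inter by (auto simp: level_def diam_le_def)
    have "real (card (level F k)) \<le> ?p (CARD('n) - k + 1)" if "\<forall>D\<in>level F k. A \<inter> B \<subseteq> D"
      using card_level_le_superspaces[OF assms(1) sub, of k] that s(2) assms(3,4) by (simp add: Suc_diff_le)
    moreover have "real (card (level F k)) \<le> ?p (Suc k)" if "\<forall>D\<in>level F k. D \<subseteq> vec.span (A \<union> B)"
      using card_level_le_hyperplanes[OF assms(1), of "vec.span (A \<union> B)" k] that s(3) by (simp del: vec.dim_span)
    ultimately show ?thesis using s(1) mono[of "CARD('n) - k + 1" m] mono[of "Suc k" m] assms(5,6) by force
  next
    case False
    then have "card (level F k) \<le> 1" by (metis card_le_Suc0_iff_eq finite One_nat_def)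
    then show ?thesis using p1 by linarith
  qed
qed

lemma card_level_1_le:
  fixes F :: "('a::{field,finite} ^ 'n) set set"
  assumes "diam_le d F" "U \<in> F" "d \<le> vec.dim U" "d \<ge> 1"
  shows "real (card (level F 1)) \<le> gaussian_binomial CARD('a) (d + 1) 1"
proof (cases "level F 1 = {}")
  case True
  then show ?thesis using gaussian_binomial_nonneg[OF card_field_ge2[where 'a='a]] by simp
next
  case False
  then obtain A where A: "A \<in> F" "vec.dim A = 1" by (auto simp: level_def)
  have u: "vec.dim U \<le> d + 1" using diam_le_dim[OF assms(1,2) A(1)] A by simp
  have "1 \<le> vec.dim (B \<inter> U)" if "B \<in> level F 1" for B
    using diam_leD[OF assms(1), of B U] that assms(2,3) by (auto simp: level_def simp del: vec.dim_eq_0)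
  then have "real (card (level F 1)) \<le> gaussian_binomial CARD('a) (vec.dim U) 1 * gaussian_binomial CARD('a) (CARD('n) - 1) (1 - 1)"
    by (intro card_level_le_meeting[OF assms(1) diam_le_subspace[OF assms(1,2)]]) auto
  then show ?thesis using gaussian_binomial_mono[OF card_field_ge2[where 'a='a] u] by simp
qed

text \<open>
  The dimensions that occur differ by at most \<open>d\<close>; \<open>m\<close> is the least positive one. The zero
  subspace is accounted for by the summand \<open>1\<close>, which later matches \<open>[n, 0]\<close>.
\<close>

lemma card_family_window:
  fixes F :: "('a::{field,finite} ^ 'n) set set"
  assumes "diam_le d F" "A \<in> F" "vec.dim A \<ge> 1"
  obtains m where "1 \<le> m" "real (card F) \<le> 1 + (\<Sum>j\<le>d. real (card (level F (m + j))))"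
proof -
  define P where "P = (\<lambda>k. 1 \<le> k \<and> level F k \<noteq> {})"
  define m where "m = (LEAST k. P k)"
  have "P (vec.dim A)" using assms(2,3) by (auto simp: P_def level_def)
  then have Pm: "P m" unfolding m_def by (rule LeastI)
  have least: "m \<le> k" if "P k" for k unfolding m_def using that by (rule Least_le)
  obtain B where B: "B \<in> F" "vec.dim B = m" using Pm by (auto simp: P_def level_def)
  have "F \<subseteq> level F 0 \<union> (\<Union>j\<le>d. level F (m + j))"
  proof
    fix D assume D: "D \<in> F"
    show "D \<in> level F 0 \<union> (\<Union>j\<le>d. level F (m + j))"
    proof (cases "vec.dim D = 0")
      case False
      then have "m \<le> vec.dim D" using D by (intro least) (auto simp: P_def level_def simp del: vec.dim_eq_0)
      moreover have "vec.dim D \<le> m + d" using diam_le_dim[OF assms(1) D B(1)] B by simp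
      ultimately show ?thesis using D by (auto simp: level_def intro!: bexI[of _ "vec.dim D - m"])
    qed (use D in \<open>auto simp: level_def\<close>)
  qed
  then have "card F \<le> card (level F 0 \<union> (\<Union>j\<le>d. level F (m + j)))" by (intro card_mono) auto
  also have "\<dots> \<le> card (level F 0) + card (\<Union>j\<le>d. level F (m + j))" by (rule card_Un_le)
  also have "\<dots> \<le> card (level F 0) + (\<Sum>j\<le>d. card (level F (m + j)))"
    by (intro add_left_mono card_UN_le) auto
  finally have "real (card F) \<le> real (card (level F 0)) + (\<Sum>j\<le>d. real (card (level F (m + j))))"
    by (simp flip: of_nat_sum of_nat_add)
  moreover have "real (card (level F 0)) \<le> 1" using card_level_le_all[OF assms(1), of 0] by simp
  ultimately show ?thesis using that[of m] Pm by (auto simp: P_def)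
qed

text \<open>
  The distance of subspaces of dimensions \<open>k\<close> and \<open>k + 1\<close> is odd, hence \<open>1\<close> if it is at most
  \<open>2\<close>; so every member of the lower level is contained in every member of the upper one.
\<close>

lemma adjacent_levels_diam_2:
  fixes F :: "('a::{field,finite} ^ 'n) set set"
  assumes "diam_le 2 F" "level F k \<noteq> {}" "level F (Suc k) \<noteq> {}"
  shows "real (card (level F k)) \<le> gaussian_binomial CARD('a) (Suc k) 1"
    and "real (card (level F (Suc k))) \<le> gaussian_binomial CARD('a) (CARD('n) - k) 1"
proof -
  have L: "vec.subspace D" "vec.dim D = j" if "D \<in> level F j" for D j
    using that assms(1) by (auto simp: level_def diam_le_def)
  have inc: "A \<subseteq> U" if "A \<in> level F k" "U \<in> level F (Suc k)" for A U
    using that diam_leD[OF assms(1), of A U] L[OF that(1)] L[OF that(2)]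
    by (intro subset_of_dim_Int) (auto simp: level_def)
  obtain A U where A: "A \<in> level F k" and U: "U \<in> level F (Suc k)" using assms by blast
  show "real (card (level F k)) \<le> gaussian_binomial CARD('a) (Suc k) 1"
    using inc U L[OF U] by (intro card_level_le_hyperplanes[OF assms(1)]) auto
  show "real (card (level F (Suc k))) \<le> gaussian_binomial CARD('a) (CARD('n) - k) 1"
    using card_level_le_superspaces[OF assms(1), of A "Suc k"] inc A L[OF A] by simp
qed

text \<open>
  At most three consecutive levels of positive dimension occur. Two levels of size at most
  \<open>[n - 1, 1]\<close> fit into \<open>[n, 1]\<close>. If all three are present, then the members of each level all
  lie in, or all contain, a fixed member of a neighbouring level, which reduces the bound for
  each level to \<open>[n - 2, 1]\<close>, and three levels of that size fit as well.
\<close>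

lemma card_le_off_ends_diam_2:
  fixes F :: "('a::{field,finite} ^ 'n) set set"
  assumes "diam_le 2 F" "4 < CARD('n)" "U \<in> F" "2 \<le> vec.dim U"
    and high: "\<And>A. A \<in> F \<Longrightarrow> vec.dim A + 1 < CARD('n)"
  shows "real (card F) \<le> 1 + gaussian_binomial CARD('a) CARD('n) 1"
proof -
  let ?n = "CARD('n)" and ?p = "\<lambda>m. gaussian_binomial CARD('a) m 1" and ?f = "\<lambda>k. real (card (level F k))"
  note mono = gaussian_binomial_mono[OF card_field_ge2[where 'a='a]]
  note double = gaussian_binomial_1_double[OF card_field_ge2[where 'a='a]]
  have empty: "?f k = 0" if "k \<ge> ?n - 1" for k
    using high that by (force simp: level_def)
  have nn: "?p k \<ge> 0" for k by (rule gaussian_binomial_nonneg[OF card_field_ge2])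
  have p: "2 * ?p (?n - 1) \<le> ?p ?n" "2 * ?p (?n - 2) \<le> ?p (?n - 1)"
    using double[of ?n] double[of "?n - 1"] assms(2) by (simp_all add: numeral_2_eq_2)
  have le: "?f k \<le> ?p (?n - 1)" if k: "1 \<le> k" for k
  proof -
    consider "k = 1" | "2 \<le> k" "k + 2 \<le> ?n" | "k \<ge> ?n - 1" using k by linarith
    then show ?thesis
    proof cases
      case 1
      have "3 \<le> ?n - 1" using assms(2) by linarith
      from card_level_1_le[OF assms(1,3,4)] mono[OF this] 1 show ?thesis by simp
    next
      case 2
      then show ?thesis by (intro card_level_small_diam[OF assms(1)]) auto
    next
      case 3
      then show ?thesis using empty nn by simp
    qed
  qed
  obtain m where m: "1 \<le> m" "real (card F) \<le> 1 + (\<Sum>j\<le>2. ?f (m + j))"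
    using card_family_window[OF assms(1,3)] assms(4) by auto
  have sum: "(\<Sum>j\<le>2. ?f (m + j)) = ?f m + ?f (Suc m) + ?f (Suc (Suc m))"
    by (simp add: numeral_2_eq_2)
  have fle: "?f m \<le> ?p (?n - 1)" "?f (Suc m) \<le> ?p (?n - 1)" "?f (Suc (Suc m)) \<le> ?p (?n - 1)"
    using m(1) by (intro le; simp)+
  show ?thesis
  proof (cases "level F m \<noteq> {} \<and> level F (Suc m) \<noteq> {} \<and> level F (Suc (Suc m)) \<noteq> {}")
    case True
    then have h: "Suc (Suc m) < ?n - 1" using empty[of "Suc (Suc m)"] by (auto simp: not_less[symmetric])
    then have b: "?p (Suc m) \<le> ?p (?n - 2)" "?p (Suc (Suc m)) \<le> ?p (?n - 2)" "?p (?n - Suc m) \<le> ?p (?n - 2)"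
      by (intro mono; use h m(1) in linarith)+
    have "?f m \<le> ?p (?n - 2)" using adjacent_levels_diam_2(1)[OF assms(1), of m] True b by auto
    moreover have "?f (Suc m) \<le> ?p (?n - 2)" "?f (Suc (Suc m)) \<le> ?p (?n - 2)"
      using adjacent_levels_diam_2[OF assms(1), of "Suc m"] True b by auto
    ultimately show ?thesis using m(2) sum p nn[of "?n - 2"] by linarith
  next
    case False
    then have "?f m = 0 \<or> ?f (Suc m) = 0 \<or> ?f (Suc (Suc m)) = 0" by auto
    then show ?thesis using m(2) sum p fle by linarith
  qed
qed

text \<open>
  At most four consecutive levels of positive dimension occur. Each has at most \<open>[n - 2, 1]\<close>
  members, except for the dimensions \<open>2\<close> and \<open>n - 2\<close>, where the bound is \<open>[n - 1, 1]\<close>. The total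
  is at most \<open>2 * [n - 1, 1] + 2 * [n - 2, 1]\<close>.
\<close>

lemma card_le_off_ends_diam_3:
  fixes F :: "('a::{field,finite} ^ 'n) set set"
  assumes "diam_le 3 F" "6 < CARD('n)" "U \<in> F" "3 \<le> vec.dim U"
    and high: "\<And>A. A \<in> F \<Longrightarrow> vec.dim A + 1 < CARD('n)"
  shows "real (card F) \<le> 1 + gaussian_binomial CARD('a) CARD('n) 1 + gaussian_binomial CARD('a) (CARD('n) - 1) 1"
proof -
  let ?n = "CARD('n)" and ?p = "\<lambda>m. gaussian_binomial CARD('a) m 1" and ?f = "\<lambda>k. real (card (level F k))"
  note mono = gaussian_binomial_mono[OF card_field_ge2[where 'a='a]]
  note double = gaussian_binomial_1_double[OF card_field_ge2[where 'a='a]]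
  have empty: "?f k = 0" if "k \<ge> ?n - 1" for k
    using high that by (force simp: level_def)
  have nn: "?p k \<ge> 0" for k by (rule gaussian_binomial_nonneg[OF card_field_ge2])
  have p: "2 * ?p (?n - 1) \<le> ?p ?n" "2 * ?p (?n - 2) \<le> ?p (?n - 1)"
    using double[of ?n] double[of "?n - 1"] assms(2) by (simp_all add: numeral_2_eq_2)
  have small: "?f k \<le> ?p (?n - 2)" if k: "1 \<le> k" "k \<noteq> 2" "k \<noteq> ?n - 2" for k
  proof -
    consider "k = 1" | "3 \<le> k" "k + 3 \<le> ?n" | "k \<ge> ?n - 1" using k by linarith
    then show ?thesis
    proof cases
      case 1
      have "4 \<le> ?n - 2" using assms(2) by linarith
      from card_level_1_le[OF assms(1,3,4)] mono[OF this] 1 show ?thesis by simp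
    next
      case 2
      then show ?thesis by (intro card_level_small_diam[OF assms(1)]) auto
    next
      case 3
      then show ?thesis using empty nn by simp
    qed
  qed
  have le: "?f k \<le> ?p (?n - 1)" if "1 \<le> k" for k
  proof (cases "k = 2 \<or> k = ?n - 2")
    case True
    then show ?thesis using assms(2) by (intro card_level_small_diam[OF assms(1)]) auto
  next
    case False
    then show ?thesis using small[OF that] p nn[of "?n - 2"] by linarith
  qed
  obtain m where m: "1 \<le> m" "real (card F) \<le> 1 + (\<Sum>j\<le>3. ?f (m + j))"
    using card_family_window[OF assms(1,3)] assms(4) by auto
  have sum: "(\<Sum>j\<le>3. ?f (m + j)) = ?f m + ?f (m + 1) + ?f (m + 2) + ?f (m + 3)"
    by (simp add: numeral_3_eq_3)
  have fle: "?f m \<le> ?p (?n - 1)" "?f (m + 1) \<le> ?p (?n - 1)" "?f (m + 2) \<le> ?p (?n - 1)" "?f (m + 3) \<le> ?p (?n - 1)"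
    using m(1) by (intro le; simp)+
  have sm: "?f (m + j) \<le> ?p (?n - 2)" if "m + j \<noteq> 2" "m + j \<noteq> ?n - 2" for j
    using that m(1) by (intro small) auto
  have "?f m + ?f (m + 1) + ?f (m + 2) + ?f (m + 3) \<le> 2 * ?p (?n - 1) + 2 * ?p (?n - 2)"
  proof -
    consider "m = 1" | "m = 2" | "m \<ge> 3" using m(1) by linarith
    then show ?thesis
    proof cases
      case 1
      have "?f (m + 0) \<le> ?p (?n - 2)" "?f (m + 2) \<le> ?p (?n - 2)" "?f (m + 3) \<le> ?p (?n - 2)"
        by (rule sm; use 1 assms(2) in linarith)+
      then show ?thesis using fle nn[of "?n - 2"] p unfolding add_0_right by linarith
    next
      case 2
      have "?f (m + 1) \<le> ?p (?n - 2)" "?f (m + 2) \<le> ?p (?n - 2)"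
        by (rule sm; use 2 assms(2) in linarith)+
      then show ?thesis using fle by linarith
    next
      case 3
      then have "m + j \<noteq> 2" for j by simp
      then have *: "?f (m + j) \<le> ?p (?n - 2) \<or> ?n - 2 = m + j" for j using sm[of j] by metis
      have "?p (?n - 2) \<le> ?p (?n - 1)" using p nn[of "?n - 2"] by linarith
      then show ?thesis using *[of 0] *[of 1] *[of 2] *[of 3] fle
        unfolding add_0_right by (elim disjE) linarith+
    qed
  qed
  then show ?thesis using m(2) sum p by linarith
qed

section \<open>The diameter theorem\<close>

abbreviation (input) kleitman_bound :: "nat \<Rightarrow> nat \<Rightarrow> nat \<Rightarrow> real" where
  "kleitman_bound q n d \<equiv> (\<Sum>i\<le>d div 2. gaussian_binomial q n i)
     + (if odd d then gaussian_binomial q (n - 1) (d div 2) else 0)"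

lemma card_le_low_dims:
  fixes F :: "('a::{field,finite} ^ 'n) set set"
  assumes "diam_le d F" "2 * d < CARD('n)" "d \<ge> 2"
    and low: "\<And>A. A \<in> F \<Longrightarrow> vec.dim A + d div 2 \<le> d"
  shows "real (card F) \<le> kleitman_bound CARD('a) CARD('n) d"
proof -
  let ?t = "d div 2" and ?f = "\<lambda>k. real (card (level F k))"
  have "level F k = {}" if "k > d - ?t" for k using low that by (fastforce simp: level_def)
  then have "(\<Sum>k\<le>CARD('n). ?f k) = (\<Sum>k\<le>d - ?t. ?f k)"
    using assms(2) by (intro sum.mono_neutral_right) auto
  then have total: "real (card F) = (\<Sum>k\<le>d - ?t. ?f k)"
    using arg_cong[OF card_family_levels[of F], of real] by (simp only: of_nat_sum)
  have le: "(\<Sum>k\<le>?t. ?f k) \<le> (\<Sum>i\<le>?t. gaussian_binomial CARD('a) CARD('n) i)"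
    by (intro sum_mono card_level_le_all[OF assms(1)])
  show ?thesis
  proof (cases "even d")
    case True
    then have "d - ?t = ?t" by auto
    then show ?thesis using total le True by simp
  next
    case False
    then have d: "d = 2 * ?t + 1" by (simp add: odd_two_times_div_two_succ)
    then have "d - ?t = Suc ?t" by linarith
    then have "real (card F) = (\<Sum>k\<le>?t. ?f k) + ?f (?t + 1)" using total by simp
    moreover have "?f (?t + 1) \<le> gaussian_binomial CARD('a) (CARD('n) - 1) ?t"
      using assms d by (intro card_level_intersecting) auto
    ultimately show ?thesis using le False by simp
  qed
qed

lemma card_le_off_ends:
  fixes F :: "('a::{field,finite} ^ 'n) set set"
  assumes "diam_le d F" "2 * d < CARD('n)" "d \<ge> 2" "U \<in> F" "d < vec.dim U + d div 2"
    and high: "\<And>A. A \<in> F \<Longrightarrow> vec.dim A + d div 2 < CARD('n)"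
  shows "real (card F) \<le> kleitman_bound CARD('a) CARD('n) d"
proof -
  have nn: "gaussian_binomial CARD('a) m k \<ge> 0" for m k by (rule gaussian_binomial_nonneg[OF card_field_ge2])
  consider "d = 2" | "d = 3" | "d div 2 \<ge> 2" using assms(3) by linarith
  then show ?thesis
  proof cases
    case 1
    then show ?thesis using card_le_off_ends_diam_2[of F U] assms by simp
  next
    case 2
    then show ?thesis using card_le_off_ends_diam_3[of F U] assms by simp
  next
    case 3
    then have "real (card F) \<le> (\<Sum>i\<le>d div 2. gaussian_binomial CARD('a) CARD('n) i)"
      using card_le_off_ends_large_diam[OF assms(1) refl _ assms(2,4,5) high] by simp
    then show ?thesis using nn[of "CARD('n) - 1" "d div 2"] by auto
  qed
qed

text \<open>
  A family that is neither low nor high in the sense of \<open>card_le_low_dims\<close> has members \<open>U\<close> and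
  \<open>U'\<close> that are witnesses for this. If it has a member of dimension at least \<open>n - t\<close>, then all
  dimensions exceed \<open>t\<close>, as \<open>n - 2 * t > d\<close>, and \<open>card_le_off_ends\<close> applies to the dual family
  with \<open>perp U'\<close> instead of \<open>U\<close>.
\<close>

lemma card_le_large_ambient:
  fixes F :: "('a::{field,finite} ^ 'n) set set"
  assumes "diam_le d F" "2 * d < CARD('n)" "d \<ge> 2"
  shows "real (card F) \<le> kleitman_bound CARD('a) CARD('n) d"
proof -
  let ?t = "d div 2"
  have dp: "vec.dim (perp A) = CARD('n) - vec.dim A" if "A \<in> F" for A
    using dim_perp[OF diam_le_subspace[OF assms(1) that]] by simp
  note dual = diam_le_perp[OF assms(1)] card_perp_family[OF assms(1)]
  consider (low) "\<forall>A\<in>F. vec.dim A + ?t \<le> d"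
    | (high) "\<forall>A\<in>F. CARD('n) - vec.dim A + ?t \<le> d"
    | (mid) U U' where "U \<in> F" "d < vec.dim U + ?t" "U' \<in> F" "d < CARD('n) - vec.dim U' + ?t"
    by (meson not_le)
  then show ?thesis
  proof cases
    case low
    then show ?thesis using card_le_low_dims[OF assms] by blast
  next
    case high
    have "real (card (perp ` F)) \<le> kleitman_bound CARD('a) CARD('n) d"
      by (rule card_le_low_dims[OF dual(1) assms(2,3)]) (use high dp in auto)
    then show ?thesis by (simp only: dual(2))
  next
    case mid
    show ?thesis
    proof (cases "\<forall>A\<in>F. vec.dim A + ?t < CARD('n)")
      case True
      then show ?thesis using card_le_off_ends[OF assms mid(1,2)] by blast
    next
      case False
      then obtain A where A: "A \<in> F" "CARD('n) \<le> vec.dim A + ?t" by auto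
      have "vec.dim (perp B) + ?t < CARD('n)" if "B \<in> F" for B
        using diam_le_dim[OF assms(1) A(1) that] A(2) assms(2) dp[OF that] vec_dim_le[of B] by auto
      then have "real (card (perp ` F)) \<le> kleitman_bound CARD('a) CARD('n) d"
        using mid(3,4) dp by (intro card_le_off_ends[OF dual(1) assms(2,3), of "perp U'"]) auto
      then show ?thesis by (simp only: dual(2))
    qed
  qed
qed

text \<open>
  Distances between subspaces of equal dimension are even, so a family of diameter at most \<open>1\<close>
  has at most one member of each dimension.
\<close>

lemma card_le_diam_le_1:
  fixes F :: "('a::{field,finite} ^ 'n) set set"
  assumes "diam_le d F" "d \<le> 1"
  shows "card F \<le> d + 1"
proof (cases "F = {}")
  case False
  define m where "m = Min (vec.dim ` F)"
  have m: "m \<in> vec.dim ` F" unfolding m_def using False by (intro Min_in) auto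
  then obtain B where B: "B \<in> F" "vec.dim B = m" by auto
  have "inj_on vec.dim F"
  proof (rule inj_onI)
    fix A A' assume *: "A \<in> F" "A' \<in> F" "vec.dim A = vec.dim A'"
    then have "vec.dim A \<le> vec.dim (A \<inter> A')" using diam_leD[OF assms(1), of A A'] assms(2) by simp
    then show "A = A'"
      using subset_of_dim_Int[of A A'] subset_of_dim_Int[of A' A] * diam_le_subspace[OF assms(1)]
      by (metis Int_commute subset_antisym)
  qed
  moreover have "vec.dim ` F \<subseteq> {m..m + d}"
  proof
    fix k assume "k \<in> vec.dim ` F"
    then obtain A where A: "A \<in> F" "k = vec.dim A" by auto
    have "m \<le> k" unfolding m_def using A by (intro Min_le) auto
    then show "k \<in> {m..m + d}" using diam_le_dim[OF assms(1) A(1) B(1)] A B by simp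
  qed
  ultimately have "card F \<le> card {m..m + d}" by (intro card_inj_on_le) auto
  then show ?thesis by simp
qed simp

theorem theorem1p2:
  fixes F :: "('a::{field,finite} ^ 'n) set set"
    and q n d t :: nat
  assumes "q = CARD('a)" and "n = CARD('n)"
    and "n = d + 1 \<or> n > 2 * d"
    and "t = d div 2"
    and "F \<subseteq> pverts q_hamming_graph"
    and "graph_diam q_hamming_graph F \<le> ereal (real d)"
  shows "(d = 2 * t \<longrightarrow> real (card F) \<le> (\<Sum>i=0..t. gaussian_binomial q n i)) \<and>
         (d = 2 * t + 1 \<longrightarrow>
            real (card F) \<le> (\<Sum>i=0..t. gaussian_binomial q n i) + gaussian_binomial q (n - 1) t)"
proof -
  have diam: "diam_le d F" by (rule diam_le_of_graph_diam[OF assms(5,6)])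
  have range: "{0..t} = {..t}" by auto
  consider "n = d + 1" | "n > 2 * d" "d \<ge> 2" | "d \<le> 1" using assms(3) by linarith
  then show ?thesis
  proof cases
    case 1
    then have "CARD('n) = d + 1" using assms(2) by simp
    then show ?thesis
      unfolding range assms(1,2) using card_le_ambient_Suc[OF diam, of t] by blast
  next
    case 2
    have "2 * d < CARD('n)" using 2 assms(2) by simp
    then have bound: "real (card F) \<le> kleitman_bound q n d"
      unfolding assms(1,2) by (intro card_le_large_ambient[OF diam] 2)
    show ?thesis
    proof (intro conjI impI)
      assume "d = 2 * t"
      then have "even d" by simp
      with bound show "real (card F) \<le> (\<Sum>i=0..t. gaussian_binomial q n i)"
        by (simp add: atMost_atLeast0 assms(4))
    next
      assume "d = 2 * t + 1"
      then have "odd d" by simp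
      with bound show "real (card F) \<le> (\<Sum>i=0..t. gaussian_binomial q n i) + gaussian_binomial q (n - 1) t"
        by (simp add: atMost_atLeast0 assms(4))
    qed
  next
    case 3
    then have "t = 0" using assms(4) by simp
    have "d = 0 \<or> d = 1" using 3 by linarith
    then show ?thesis using card_le_diam_le_1[OF diam 3] \<open>t = 0\<close> by (elim disjE) simp_all
  qed
qed

end
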